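(* For all $\zeta>0$ there exist positive constants $k,C_1,C_2,N$ such that for all measures $\mu$ on $\mathbb{R}$ (with associated exponential family $\mathcal{P}_\mu=\{P_\theta\}_{\theta\in\Phi}$), all $\theta_0\in\Phi$ and all $n\in\mathbb{N}$ with $n\ge N$: if - $\varepsilon_n\ge\frac{k}{\sqrt n}$, - $\displaystyle\max_{\theta'\in\Phi(\theta_0)}\frac{\mathbb{E}_{\theta'}\big((x-A'(\theta'))^4\big)}{A''(\theta')^2}\le\zeta$, where $\Phi(\theta_0)=[\theta_0-\kappa(\theta_0),\theta_0+\kappa(\theta_0)]$, - $\kappa(\theta_0)\ge\frac{C_2}{\sqrt{nA''(\theta_0)}}$, then $$\mathcal{E}^{\rm loc}_n(P_{\theta_0},\mathcal{P}_\mu,\mathcal{F}_{\varepsilon_n},\theta)\in\left[\frac{C_1}{2\sqrt{nA''(\theta_0)}},\ \frac{C_2}{2\sqrt{nA''(\theta_0)}}\right].$$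
   Context: Exponential family: for a measure $\mu$ on $\mathbb{R}$, $A(\theta)=\ln\int e^{\theta x}d\mu(x)$, $\Phi=\{\theta: A(\theta)<\infty\}$, and for $\theta\in\Phi$, $P_\theta$ is the distribution with density $p_\theta(x)=e^{\theta x-A(\theta)}$ relative to $\mu$. Then $\mathbb{E}_\theta[x]=A'(\theta)$ and $\mathrm{var}_\theta(x)=A''(\theta)$. It is implicitly assumed that $\mu$ is not concentrated at one point (so $A''>0$) and that parameters considered are interior points of $\Phi$. The statistic being estimated is the parameter, $\theta(P_\theta)=\theta$. $\kappa(\theta)=\sup\{r : \forall\theta'\in[\theta-r,\theta+r],\ A''(\theta)/A''(\theta')\in[\tfrac12,2]\}$ (the interval being required to lie where $A''$ is defined; $\kappa(\theta)$ may be $+\infty$). A randomized mechanism $M$ is $\varepsilon$-differentially private if for all datasets $d,d'$ of size $n$ differing in a single record and all events $E$, $\Pr[M(d)\in E]\le e^\varepsilon\Pr[M(d')\in E]$; $\mathcal{F}_\varepsilon$ is the set of all $\varepsilon$-differentially private real-valued estimators. $\varepsilon_n>0$ is the privacy parameter at sample size $n$. $\mathfrak{R}_n(P,\hat\theta)$ is the smallest $r\ge0$ such that for $n$ i.i.d. samples from $P$, $|\hat\theta(X_1,\dots,X_n)-\theta(P)|\le r$ with probability at least $0.75$, and $$\mathcal{E}^{\rm loc}_n(P,\mathcal{P},\mathcal{F},\theta)=\sup_{Q\in\mathcal{P}}\inf_{\hat\theta\in\mathcal{F}}\max\{\mathfrak{R}_n(P,\hat\theta),\mathfrak{R}_n(Q,\hat\theta)\}.$$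 *)

theory Defs
  imports "HOL-Probability.Probability"
begin

text \<open>
  The moment generating function is kept real-valued; finiteness of the integral
  (equivalently \<open>A(\<theta>) < \<infinity>\<close>) is recorded in \<open>nat_params\<close>, and \<open>log_partition\<close> is
  meaningful only there. For the same reason its derivatives are meaningful only on
  \<open>interior (nat_params \<mu>)\<close>.
\<close>

definition log_partition :: "real measure \<Rightarrow> real \<Rightarrow> real" where
  "log_partition \<mu> \<theta> = ln (LINT x|\<mu>. exp (\<theta> * x))"

definition nat_params :: "real measure \<Rightarrow> real set" where
  "nat_params \<mu> = {\<theta>. (\<integral>\<^sup>+ x. ennreal (exp (\<theta> * x)) \<partial>\<mu>) < \<infinity>}"

definition exp_fam :: "real measure \<Rightarrow> real \<Rightarrow> real measure" where
  "exp_fam \<mu> \<theta> = density \<mu> (\<lambda>x. ennreal (exp (\<theta> * x - log_partition \<mu> \<theta>)))"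

text \<open>Well defined because \<open>\<theta> \<mapsto> P\<^sub>\<theta>\<close> is injective on \<open>nat_params \<mu>\<close> unless \<open>\<mu>\<close> is
  concentrated at one point.\<close>

definition exp_fam_param :: "real measure \<Rightarrow> real measure \<Rightarrow> real" where
  "exp_fam_param \<mu> P = (THE \<theta>. \<theta> \<in> nat_params \<mu> \<and> exp_fam \<mu> \<theta> = P)"

definition concentrated_at_point :: "real measure \<Rightarrow> bool" where
  "concentrated_at_point \<mu> \<longleftrightarrow> (\<exists>c. AE x in \<mu>. x = c)"

text \<open>Negative \<open>r\<close> give an empty interval and do not affect the supremum when \<open>\<theta>\<close> is
  interior, since then \<open>r = 0\<close> qualifies.\<close>

definition kappa :: "real measure \<Rightarrow> real \<Rightarrow> ereal" where
  "kappa \<mu> \<theta> = Sup (ereal ` {r. {\<theta> - r..\<theta> + r} \<subseteq> interior (nat_params \<mu>) \<and>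
     (\<forall>\<theta>'\<in>{\<theta> - r..\<theta> + r}.
        deriv (deriv (log_partition \<mu>)) \<theta> / deriv (deriv (log_partition \<mu>)) \<theta>' \<in> {1/2..2})})"

definition kappa_interval :: "real measure \<Rightarrow> real \<Rightarrow> real set" where
  "kappa_interval \<mu> \<theta> =
     {\<theta>'. ereal \<theta> - kappa \<mu> \<theta> \<le> ereal \<theta>' \<and> ereal \<theta>' \<le> ereal \<theta> + kappa \<mu> \<theta>}"

text \<open>
  A dataset of size \<open>n\<close> is a point of \<open>\<Pi>\<^sub>M i\<in>{..<n}. borel\<close>, and a randomized real-valued
  estimator is a Markov kernel from datasets to the reals.
\<close>

definition estimators :: "nat \<Rightarrow> ((nat \<Rightarrow> real) \<Rightarrow> real measure) set" where
  "estimators n = measurable (\<Pi>\<^sub>M i\<in>{..<n}. borel) (prob_algebra borel)"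

definition differentially_private ::
    "nat \<Rightarrow> real \<Rightarrow> ((nat \<Rightarrow> real) \<Rightarrow> real measure) \<Rightarrow> bool" where
  "differentially_private n \<epsilon> M \<longleftrightarrow>
     (\<forall>d \<in> space (\<Pi>\<^sub>M i\<in>{..<n}. (borel :: real measure)).
      \<forall>d' \<in> space (\<Pi>\<^sub>M i\<in>{..<n}. (borel :: real measure)).
        (\<exists>!i. i < n \<and> d i \<noteq> d' i) \<longrightarrow>
        (\<forall>E \<in> sets borel. measure (M d) E \<le> exp \<epsilon> * measure (M d') E))"

definition dp_estimators :: "nat \<Rightarrow> real \<Rightarrow> ((nat \<Rightarrow> real) \<Rightarrow> real measure) set" where
  "dp_estimators n \<epsilon> = {M \<in> estimators n. differentially_private n \<epsilon> M}"

text \<open>The probability is over both the sample and the internal randomness of \<open>M\<close>. The set of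
  admissible \<open>r\<close> is nonempty, bounded below and closed (the probability is right-continuous
  in \<open>r\<close>), so the infimum is its least element.\<close>

definition risk ::
    "nat \<Rightarrow> (real measure \<Rightarrow> real) \<Rightarrow> real measure \<Rightarrow> ((nat \<Rightarrow> real) \<Rightarrow> real measure) \<Rightarrow> real" where
  "risk n stat P M = Inf {r. 0 \<le> r \<and>
     3/4 \<le> measure ((\<Pi>\<^sub>M i\<in>{..<n}. P) \<bind> M) {y. \<bar>y - stat P\<bar> \<le> r}}"

definition local_minimax ::
    "nat \<Rightarrow> real measure \<Rightarrow> real measure set \<Rightarrow> ((nat \<Rightarrow> real) \<Rightarrow> real measure) set \<Rightarrow>
     (real measure \<Rightarrow> real) \<Rightarrow> ereal" where
  "local_minimax n P \<P> \<F> stat =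
     (SUP Q\<in>\<P>. INF M\<in>\<F>. ereal (max (risk n stat P M) (risk n stat Q M)))"

end

theory Submission
  imports Defs
begin

text \<open>
  Lower bound: Le Cam's two-point method with \<open>\<theta>\<^sub>0\<close> and \<open>\<theta>\<^sub>0 + h\<close>, where \<open>h\<close> is of order
  \<open>1 / sqrt (n A''(\<theta>\<^sub>0))\<close>. The second moment of the \<open>n\<close>-sample likelihood ratio is the exponential of
  \<open>n\<close> times a second difference of \<open>A\<close>, hence close to 1.

  Upper bound: if \<open>\<bar>\<theta> - \<theta>\<^sub>0\<bar> \<le> D := C2 / sqrt (n A''(\<theta>\<^sub>0))\<close>, the constant estimator at the midpoint
  suffices. Otherwise \<open>\<theta>\<close> and \<open>\<theta>\<^sub>0\<close> are told apart by a private test: with \<open>g\<close> the standardised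
  observation, clamped and rescaled to \<open>[0, 1]\<close>, choose the larger parameter with a probability that
  is a logistic function of \<open>\<epsilon> (\<Sum>\<^sub>i g(x\<^sub>i) - \<tau>)\<close>. Such a test is \<open>\<epsilon>\<close>-private because both the logistic
  function and its complement have 1-Lipschitz logarithms. It succeeds because the means of \<open>g\<close>
  differ by at least \<open>12 / sqrt n\<close>: one has \<open>d/d\<theta> E\<^sub>\<theta> g = cov\<^sub>\<theta>(x, g)\<close>, and the fourth moment bound
  shows that clamping loses at most half of the variance. As \<open>E\<^sub>\<theta> g\<close> increases with \<open>\<theta>\<close>, it is enough
  to know the gap at distance \<open>D / 2\<close>, inside the interval where \<open>A''\<close> is controlled.
\<close>

section \<open>Exponential families\<close>

lemma abs_exp_minus_one_le:
  fixes y :: real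
  shows "\<bar>exp y - 1\<bar> \<le> \<bar>y\<bar> * exp \<bar>y\<bar>"
proof (cases "y \<ge> 0")
  case True
  have "1 - y \<le> exp (- y)" using exp_ge_add_one_self[of "-y"] by simp
  hence "(1 - y) * exp y \<le> exp (-y) * exp y" by (intro mult_right_mono) auto
  thus ?thesis using True by (simp add: exp_minus field_simps)
next
  case False
  have "1 - exp y \<le> - y * 1" using exp_ge_add_one_self[of y] by linarith
  also have "\<dots> \<le> - y * exp (- y)" using False by (intro mult_left_mono) auto
  finally show ?thesis using False by simp
qed

text \<open>Dominated convergence for the difference quotients. The bound \<open>w\<close> uses the
  exponentials at \<theta> + 2d and \<theta> - 2d, both still in \<open>U\<close>: one factor
  exp(d|x|) pays for the growth of |x|, the other for the increment in the exponent.\<close>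

lemma
  fixes \<mu> :: "real measure" and f :: "real \<Rightarrow> real"
  assumes sets_eq[measurable_cong]: "sets \<mu> = sets borel"
    and f[measurable]: "f \<in> borel_measurable borel"
    and U: "open U" "\<theta> \<in> U"
    and int: "\<And>t. t \<in> U \<Longrightarrow> integrable \<mu> (\<lambda>x. f x * exp (t * x))"
  shows integrable_ident_mult_exp: "integrable \<mu> (\<lambda>x. x * f x * exp (\<theta> * x))" (is ?int)
    and has_real_derivative_integral_exp:
      "((\<lambda>t. LINT x|\<mu>. f x * exp (t * x)) has_real_derivative
        (LINT x|\<mu>. x * f x * exp (\<theta> * x))) (at \<theta>)" (is ?deriv)
proof -
  obtain e where e: "e > 0" "cball \<theta> e \<subseteq> U"
    using U open_contains_cball by blast
  define d where "d = e / 2"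
  have d: "d > 0" using e by (simp add: d_def)
  define w where "w x = (\<bar>f x * exp ((\<theta> + 2 * d) * x)\<bar> + \<bar>f x * exp ((\<theta> - 2 * d) * x)\<bar>) / d" for x
  have w: "integrable \<mu> w"
    unfolding w_def
    by (intro integrable_divide Bochner_Integration.integrable_add integrable_abs int)
       (use e in \<open>auto simp: d_def dist_real_def subset_iff\<close>)
  have bound: "\<bar>f x * exp (\<theta> * x)\<bar> * (\<bar>x\<bar> * exp (d * \<bar>x\<bar>)) \<le> w x" for x
  proof -
    have "d * \<bar>x\<bar> \<le> exp (d * \<bar>x\<bar>)" using exp_ge_add_one_self[of "d * \<bar>x\<bar>"] by linarith
    hence "d * \<bar>x\<bar> * exp (d * \<bar>x\<bar>) \<le> exp (d * \<bar>x\<bar>) * exp (d * \<bar>x\<bar>)"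
      by (intro mult_right_mono) auto
    also have "\<dots> = exp (2 * d * \<bar>x\<bar>)" by (simp flip: exp_add)
    also have "\<dots> \<le> exp (2 * d * x) + exp (- 2 * d * x)" by (cases "x \<ge> 0") (auto simp: less_imp_le)
    finally have "\<bar>f x * exp (\<theta> * x)\<bar> * (d * \<bar>x\<bar> * exp (d * \<bar>x\<bar>)) \<le>
        \<bar>f x * exp (\<theta> * x)\<bar> * (exp (2 * d * x) + exp (- 2 * d * x))"
      by (intro mult_left_mono) auto
    also have "\<dots> = w x * d"
      using d by (simp add: w_def abs_mult distrib_left distrib_right left_diff_distrib exp_add exp_diff exp_minus)
                 (simp add: field_simps)
    finally show ?thesis using d by (simp add: field_simps)
  qed
  show int': ?int
  proof (rule Bochner_Integration.integrable_bound[OF w])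
    show "AE x in \<mu>. norm (x * f x * exp (\<theta> * x)) \<le> norm (w x)"
    proof (intro AE_I2)
      fix x
      have "\<bar>x\<bar> * 1 \<le> \<bar>x\<bar> * exp (d * \<bar>x\<bar>)" using d by (intro mult_left_mono) auto
      hence "\<bar>f x * exp (\<theta> * x)\<bar> * \<bar>x\<bar> \<le> \<bar>f x * exp (\<theta> * x)\<bar> * (\<bar>x\<bar> * exp (d * \<bar>x\<bar>))"
        by (intro mult_left_mono) auto
      with bound[of x] show "norm (x * f x * exp (\<theta> * x)) \<le> norm (w x)"
        by (simp add: abs_mult mult_ac) linarith
    qed
  qed simp
  show ?deriv
    unfolding DERIV_def tendsto_at_iff_sequentially comp_def
  proof (intro allI impI)
    fix X :: "nat \<Rightarrow> real" assume X0: "\<forall>i. X i \<in> UNIV - {0}" and X: "X \<longlonglongrightarrow> 0"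
    from X d have "eventually (\<lambda>n. \<bar>X n\<bar> < d) sequentially"
      by (auto dest!: tendstoD simp: dist_real_def)
    then obtain N where N: "\<And>n. n \<ge> N \<Longrightarrow> \<bar>X n\<bar> < d"
      by (auto simp: eventually_sequentially)
    \<comment> \<open>Shifting the sequence by \<open>N\<close> makes every increment smaller than
      \<open>d\<close>, so that \<open>w\<close> dominates all terms and not just
      eventually.\<close>
    define s where "s n x = f x * exp (\<theta> * x) * ((exp (X (n + N) * x) - 1) / X (n + N))" for n x
    have lim: "(\<lambda>n. LINT x|\<mu>. s n x) \<longlonglongrightarrow> (LINT x|\<mu>. x * f x * exp (\<theta> * x))"
    proof (rule integral_dominated_convergence[where w = w])
      show "AE x in \<mu>. (\<lambda>n. s n x) \<longlonglongrightarrow> x * f x * exp (\<theta> * x)"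
      proof (intro AE_I2)
        fix x
        have "((\<lambda>h. exp (h * x)) has_real_derivative x) (at 0)"
          by (auto intro!: derivative_eq_intros)
        hence "((\<lambda>h. (exp (h * x) - 1) / h) \<longlongrightarrow> x) (at 0)"
          by (simp add: DERIV_def)
        hence "(\<lambda>n. (exp (X n * x) - 1) / X n) \<longlonglongrightarrow> x"
          using X0 X unfolding tendsto_at_iff_sequentially comp_def by blast
        hence "(\<lambda>n. (exp (X (n + N) * x) - 1) / X (n + N)) \<longlonglongrightarrow> x"
          by (rule LIMSEQ_ignore_initial_segment)
        hence "(\<lambda>n. s n x) \<longlonglongrightarrow> f x * exp (\<theta> * x) * x"
          unfolding s_def by (intro tendsto_intros)
        thus "(\<lambda>n. s n x) \<longlonglongrightarrow> x * f x * exp (\<theta> * x)" by (simp add: mult_ac)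
      qed
      show "AE x in \<mu>. norm (s n x) \<le> w x" for n
      proof (intro AE_I2)
        fix x
        define h where "h = X (n + N)"
        have h: "h \<noteq> 0" "\<bar>h\<bar> < d" using X0 N by (auto simp: h_def)
        have "\<bar>(exp (h * x) - 1) / h\<bar> \<le> \<bar>h * x\<bar> * exp \<bar>h * x\<bar> / \<bar>h\<bar>"
          unfolding abs_divide by (intro divide_right_mono abs_exp_minus_one_le) auto
        also have "\<dots> = \<bar>x\<bar> * exp (\<bar>h\<bar> * \<bar>x\<bar>)" using h by (simp add: abs_mult)
        also have "\<dots> \<le> \<bar>x\<bar> * exp (d * \<bar>x\<bar>)"
          using h by (intro mult_left_mono) (auto intro!: mult_right_mono)
        finally have "\<bar>f x * exp (\<theta> * x)\<bar> * \<bar>(exp (h * x) - 1) / h\<bar> \<le>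
            \<bar>f x * exp (\<theta> * x)\<bar> * (\<bar>x\<bar> * exp (d * \<bar>x\<bar>))"
          by (intro mult_left_mono) auto
        also have "\<dots> \<le> w x" by (rule bound)
        finally show "norm (s n x) \<le> w x" by (simp only: s_def h_def real_norm_def abs_mult)
      qed
    qed (use w in \<open>auto simp: s_def\<close>)
    have "(LINT x|\<mu>. s n x) =
        ((LINT x|\<mu>. f x * exp ((\<theta> + X (n + N)) * x)) - (LINT x|\<mu>. f x * exp (\<theta> * x))) / X (n + N)" for n
    proof -
      have "\<bar>X (n + N)\<bar> < e" using N[of "n + N"] d by (simp add: d_def)
      hence "\<theta> + X (n + N) \<in> U" using e by (auto simp: subset_iff dist_real_def)
      hence "((LINT x|\<mu>. f x * exp ((\<theta> + X (n + N)) * x)) - (LINT x|\<mu>. f x * exp (\<theta> * x))) / X (n + N)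
        = (LINT x|\<mu>. (f x * exp ((\<theta> + X (n + N)) * x) - f x * exp (\<theta> * x)) / X (n + N))"
        using U by (simp add: int)
      also have "\<dots> = (LINT x|\<mu>. s n x)"
        by (intro Bochner_Integration.integral_cong refl)
           (simp add: s_def algebra_simps exp_add diff_divide_distrib)
      finally show ?thesis ..
    qed
    with lim show "(\<lambda>n. ((LINT x|\<mu>. f x * exp ((\<theta> + X n) * x)) - (LINT x|\<mu>. f x * exp (\<theta> * x))) / X n)
        \<longlonglongrightarrow> (LINT x|\<mu>. x * f x * exp (\<theta> * x))"
      by - (rule LIMSEQ_offset[where k = N], simp)
  qed
qed

section \<open>Normalisation, moments and derivatives in an exponential family\<close>

locale exponential_family =
  fixes \<mu> :: "real measure"
  assumes sets_mu[measurable_cong]: "sets \<mu> = sets borel"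
    and not_concentrated: "\<not> concentrated_at_point \<mu>"
begin

abbreviation "P \<equiv> exp_fam \<mu>"
abbreviation "A \<equiv> log_partition \<mu>"
abbreviation "\<Theta> \<equiv> nat_params \<mu>"

lemma space_mu [simp]: "space \<mu> = UNIV"
  using sets_eq_imp_space_eq[OF sets_mu] by simp

lemma sets_P [measurable_cong, simp]: "sets (P \<theta>) = sets borel"
  by (simp add: exp_fam_def sets_mu)

lemma space_P [simp]: "space (P \<theta>) = UNIV"
  by (simp add: exp_fam_def)

lemma not_AE_eq: "\<not> (AE x in \<mu>. x = c)"
  using not_concentrated by (auto simp: concentrated_at_point_def)

lemma integrable_exp: "\<theta> \<in> \<Theta> \<Longrightarrow> integrable \<mu> (\<lambda>x. exp (\<theta> * x))"
  by (auto simp: nat_params_def integrable_iff_bounded)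

text \<open>A vanishing integral of a positive function would make \<mu> the zero measure, which
  counts as concentrated at every point.\<close>

lemma partition_pos:
  assumes "\<theta> \<in> \<Theta>" shows "0 < (LINT x|\<mu>. exp (\<theta> * x))"
proof -
  have "(LINT x|\<mu>. exp (\<theta> * x)) \<noteq> 0"
    using integral_nonneg_eq_0_iff_AE[OF integrable_exp[OF assms]] not_AE_eq[of 0]
    by (metis (mono_tags, lifting) AE_I2 eventually_mono exp_ge_zero exp_not_eq_zero)
  thus ?thesis by (simp add: less_le)
qed

lemma exp_A: "\<theta> \<in> \<Theta> \<Longrightarrow> exp (A \<theta>) = (LINT x|\<mu>. exp (\<theta> * x))"
  by (simp add: log_partition_def partition_pos)

lemma nn_integral_density_exp:
  assumes "\<theta> \<in> \<Theta>" shows "(\<integral>\<^sup>+x. ennreal (exp (\<theta> * x - A \<theta>)) \<partial>\<mu>) = 1"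
proof -
  have "(\<integral>\<^sup>+x. ennreal (exp (\<theta> * x - A \<theta>)) \<partial>\<mu>) = ennreal (LINT x|\<mu>. exp (\<theta> * x - A \<theta>))"
    using integrable_exp[OF assms] by (intro nn_integral_eq_integral) (auto simp: exp_diff)
  also have "(LINT x|\<mu>. exp (\<theta> * x - A \<theta>)) = 1"
    using partition_pos[OF assms] by (simp add: exp_diff exp_A[OF assms])
  finally show ?thesis by simp
qed

lemma prob_space_P: "\<theta> \<in> \<Theta> \<Longrightarrow> prob_space (P \<theta>)"
  unfolding exp_fam_def
  by (rule prob_spaceI) (simp add: emeasure_density nn_integral_density_exp)

lemma integrable_P_iff:
  assumes [measurable]: "f \<in> borel_measurable borel"
  shows "integrable (P \<theta>) f \<longleftrightarrow> integrable \<mu> (\<lambda>x. f x * exp (\<theta> * x))"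
proof -
  have "integrable (P \<theta>) f \<longleftrightarrow> integrable \<mu> (\<lambda>x. exp (\<theta> * x - A \<theta>) * f x)"
    unfolding exp_fam_def by (subst integrable_density) auto
  also have "(\<lambda>x. exp (\<theta> * x - A \<theta>) * f x) = (\<lambda>x. (f x * exp (\<theta> * x)) / exp (A \<theta>))"
    by (simp add: exp_diff mult_ac)
  finally show ?thesis by (simp add: divide_inverse)
qed

lemma integral_P:
  assumes [measurable]: "f \<in> borel_measurable borel"
  shows "(LINT x|P \<theta>. f x) = (LINT x|\<mu>. f x * exp (\<theta> * x - A \<theta>))"
  unfolding exp_fam_def by (subst integral_density) (auto simp: mult_ac)

lemma integral_P_quotient:
  assumes [measurable]: "f \<in> borel_measurable borel" and "\<theta> \<in> \<Theta>"
  shows "(LINT x|P \<theta>. f x) = (LINT x|\<mu>. f x * exp (\<theta> * x)) / (LINT x|\<mu>. exp (\<theta> * x))"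
  using assms by (simp add: integral_P exp_diff exp_A)

lemma exp_fam_param_P:
  assumes "\<theta> \<in> \<Theta>" shows "exp_fam_param \<mu> (P \<theta>) = \<theta>"
  unfolding exp_fam_param_def
proof (rule the_equality)
  fix \<theta>' assume *: "\<theta>' \<in> \<Theta> \<and> P \<theta>' = P \<theta>"
  \<comment> \<open>Almost everywhere uniqueness of the density rests on its total mass being
    finite, here one. Equal exponents then give a linear equation in \<open>x\<close>, which has a
    single solution unless the parameters agree.\<close>
  have "AE x in \<mu>. ennreal (exp (\<theta>' * x - A \<theta>')) = ennreal (exp (\<theta> * x - A \<theta>))"
    using * unfolding exp_fam_def
    by (subst finite_density_unique[symmetric]) (auto simp: nn_integral_density_exp)
  hence AE: "AE x in \<mu>. (\<theta>' - \<theta>) * x = A \<theta>' - A \<theta>"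
    by eventually_elim (auto simp: algebra_simps)
  show "\<theta>' = \<theta>"
  proof (rule ccontr)
    assume "\<theta>' \<noteq> \<theta>"
    hence "AE x in \<mu>. x = (A \<theta>' - A \<theta>) / (\<theta>' - \<theta>)"
      using AE by (auto elim!: eventually_mono simp: field_simps)
    with not_AE_eq show False by blast
  qed
qed (use assms in auto)

lemma interior_nat_paramsD: "\<theta> \<in> interior \<Theta> \<Longrightarrow> \<theta> \<in> \<Theta>"
  using interior_subset by auto

text \<open>Each differentiation under the integral contributes one factor \<open>x\<close>. The
  parameter is generalised because the step needs integrability on a whole neighbourhood.\<close>

lemma integrable_power_exp: "\<theta> \<in> interior \<Theta> \<Longrightarrow> integrable \<mu> (\<lambda>x. x ^ k * exp (\<theta> * x))"
proof (induction k arbitrary: \<theta>)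
  case 0
  thus ?case using integrable_exp interior_nat_paramsD by simp
next
  case (Suc k)
  have "integrable \<mu> (\<lambda>x. x * x ^ k * exp (\<theta> * x))"
    by (rule integrable_ident_mult_exp[OF sets_mu _ open_interior]) (use Suc in auto)
  thus ?case by simp
qed

lemma integrable_power_P: "\<theta> \<in> interior \<Theta> \<Longrightarrow> integrable (P \<theta>) (\<lambda>x. x ^ k)"
  by (simp add: integrable_P_iff integrable_power_exp)

lemma integrable_ident_P: "\<theta> \<in> interior \<Theta> \<Longrightarrow> integrable (P \<theta>) (\<lambda>x. x)"
  using integrable_power_P[of \<theta> 1] by simp

lemma A_has_derivative:
  assumes "\<theta> \<in> interior \<Theta>"
  shows "(A has_real_derivative (LINT x|P \<theta>. x)) (at \<theta>)"
proof -
  have "((\<lambda>t. LINT x|\<mu>. 1 * exp (t * x)) has_real_derivative (LINT x|\<mu>. x * 1 * exp (\<theta> * x))) (at \<theta>)"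
    by (rule has_real_derivative_integral_exp[OF sets_mu _ open_interior assms])
       (use integrable_exp interior_nat_paramsD in auto)
  hence "((\<lambda>t. LINT x|\<mu>. exp (t * x)) has_real_derivative (LINT x|\<mu>. x * exp (\<theta> * x))) (at \<theta>)"
    by simp
  hence "((\<lambda>t. ln (LINT x|\<mu>. exp (t * x))) has_real_derivative
      (LINT x|\<mu>. x * exp (\<theta> * x)) / (LINT x|\<mu>. exp (\<theta> * x))) (at \<theta>)"
    using partition_pos[OF interior_nat_paramsD[OF assms]] by (auto intro!: derivative_eq_intros)
  thus ?thesis
    using assms by (simp add: integral_P_quotient interior_nat_paramsD log_partition_def[abs_def])
qed

lemma deriv_A: "\<theta> \<in> interior \<Theta> \<Longrightarrow> deriv A \<theta> = (LINT x|P \<theta>. x)"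
  by (rule DERIV_imp_deriv[OF A_has_derivative])

text \<open>Quotient rule; the result is the covariance of \<open>x\<close> and \<open>f x\<close>.
  Taking \<open>f\<close> to be the identity yields the variance as A'', and taking the clamped
  statistic yields the growth of its mean.\<close>

lemma mean_has_derivative:
  assumes f[measurable]: "f \<in> borel_measurable borel"
    and int: "\<And>t. t \<in> interior \<Theta> \<Longrightarrow> integrable (P t) f"
    and \<theta>: "\<theta> \<in> interior \<Theta>"
  shows "integrable (P \<theta>) (\<lambda>x. x * f x)"
    and "((\<lambda>t. LINT x|P t. f x) has_real_derivative (LINT x|P \<theta>. (x - deriv A \<theta>) * f x)) (at \<theta>)"
proof -
  note int' = int[unfolded integrable_P_iff[OF f]]
  show int_xf: "integrable (P \<theta>) (\<lambda>x. x * f x)"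
    using integrable_ident_mult_exp[OF sets_mu f open_interior \<theta> int']
    by (subst integrable_P_iff) auto
  define Z where "Z = (LINT x|\<mu>. exp (\<theta> * x))"
  define F where "F = (LINT x|\<mu>. f x * exp (\<theta> * x))"
  have Z: "Z > 0" using partition_pos[OF interior_nat_paramsD[OF \<theta>]] by (simp add: Z_def)
  have "((\<lambda>t. LINT x|\<mu>. 1 * exp (t * x)) has_real_derivative (LINT x|\<mu>. x * 1 * exp (\<theta> * x))) (at \<theta>)"
    by (rule has_real_derivative_integral_exp[OF sets_mu _ open_interior \<theta>])
       (use integrable_exp interior_nat_paramsD in auto)
  hence 1: "((\<lambda>t. LINT x|\<mu>. exp (t * x)) has_real_derivative (LINT x|\<mu>. x * exp (\<theta> * x))) (at \<theta>)"
    by simp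
  note 2 = has_real_derivative_integral_exp[OF sets_mu f open_interior \<theta> int']
  have "((\<lambda>t. (LINT x|\<mu>. f x * exp (t * x)) / (LINT x|\<mu>. exp (t * x))) has_real_derivative
      ((LINT x|\<mu>. x * f x * exp (\<theta> * x)) * Z - F * (LINT x|\<mu>. x * exp (\<theta> * x))) / (Z * Z)) (at \<theta>)"
    using DERIV_divide[OF 2 1] Z by (simp add: Z_def F_def)
  also have "((LINT x|\<mu>. x * f x * exp (\<theta> * x)) * Z - F * (LINT x|\<mu>. x * exp (\<theta> * x))) / (Z * Z)
      = (LINT x|P \<theta>. x * f x) - deriv A \<theta> * (LINT x|P \<theta>. f x)"
    using Z \<theta> by (simp add: deriv_A integral_P_quotient interior_nat_paramsD flip: Z_def F_def)
                  (simp add: field_simps)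
  also have "\<dots> = (LINT x|P \<theta>. (x - deriv A \<theta>) * f x)"
    using int_xf int[OF \<theta>] by (simp add: left_diff_distrib)
  finally show "((\<lambda>t. LINT x|P t. f x) has_real_derivative (LINT x|P \<theta>. (x - deriv A \<theta>) * f x)) (at \<theta>)"
    by (rule has_field_derivative_transform_within_open[OF _ open_interior \<theta>])
       (simp add: integral_P_quotient interior_nat_paramsD)
qed

lemma integral_centred:
  assumes "\<theta> \<in> interior \<Theta>" shows "(LINT x|P \<theta>. x - deriv A \<theta>) = 0"
proof -
  interpret prob_space "P \<theta>" by (rule prob_space_P[OF interior_nat_paramsD[OF assms]])
  show ?thesis using assms by (simp add: integrable_ident_P deriv_A prob_space[simplified])
qed

lemma integrable_centred_power:
  assumes "\<theta> \<in> interior \<Theta>" shows "integrable (P \<theta>) (\<lambda>x. (x - c) ^ k)"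
proof -
  have "integrable (P \<theta>) (\<lambda>x. \<Sum>i\<le>k. (real (k choose i) * (- c) ^ (k - i)) * x ^ i)"
    using integrable_power_P[OF assms] by (intro Bochner_Integration.integrable_sum integrable_mult_right)
  also have "(\<lambda>x. \<Sum>i\<le>k. (real (k choose i) * (- c) ^ (k - i)) * x ^ i) = (\<lambda>x. (x - c) ^ k)"
    using binomial_ring[of _ "- c" k] by (auto simp: fun_eq_iff mult_ac)
  finally show ?thesis .
qed

lemma deriv_A_has_derivative:
  assumes \<theta>: "\<theta> \<in> interior \<Theta>"
  shows "(deriv A has_real_derivative (LINT x|P \<theta>. (x - deriv A \<theta>)\<^sup>2)) (at \<theta>)"
proof -
  define m where "m = deriv A \<theta>"
  \<comment> \<open>The covariance of \<open>x\<close> with itself is rewritten as the variance; the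
    remaining term is a multiple of the centred variable and has mean zero.\<close>
  have "(LINT x|P \<theta>. (x - m) * x) = (LINT x|P \<theta>. (x - m)\<^sup>2 + m * (x - m))"
    by (intro Bochner_Integration.integral_cong refl) (simp add: power2_eq_square algebra_simps)
  also have "\<dots> = (LINT x|P \<theta>. (x - m)\<^sup>2) + (LINT x|P \<theta>. m * (x - m))"
    using integrable_centred_power[OF \<theta>, of m 2] integrable_centred_power[OF \<theta>, of m 1]
    by (intro Bochner_Integration.integral_add integrable_mult_right) simp_all
  also have "(LINT x|P \<theta>. m * (x - m)) = 0"
    using integral_centred[OF \<theta>] by (simp only: m_def integral_mult_right_zero)
  finally have eq: "(LINT x|P \<theta>. (x - m) * x) = (LINT x|P \<theta>. (x - m)\<^sup>2)"
    by simp
  have "((\<lambda>t. LINT x|P t. x) has_real_derivative (LINT x|P \<theta>. (x - m) * x)) (at \<theta>)"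
    unfolding m_def
    by (rule mean_has_derivative(2)[where f = "\<lambda>x. x"]) (simp_all add: integrable_ident_P \<theta>)
  thus ?thesis
    unfolding eq unfolding m_def
    by (rule has_field_derivative_transform_within_open[OF _ open_interior \<theta>]) (simp add: deriv_A)
qed

lemma deriv2_A: "\<theta> \<in> interior \<Theta> \<Longrightarrow> deriv (deriv A) \<theta> = (LINT x|P \<theta>. (x - deriv A \<theta>)\<^sup>2)"
  by (rule DERIV_imp_deriv[OF deriv_A_has_derivative])

text \<open>Zero variance would concentrate P at its mean, and with it \<mu>, since the density is
  positive everywhere.\<close>

lemma deriv2_A_pos:
  assumes \<theta>: "\<theta> \<in> interior \<Theta>" shows "deriv (deriv A) \<theta> > 0"
proof -
  have "(LINT x|P \<theta>. (x - deriv A \<theta>)\<^sup>2) \<noteq> 0"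
  proof
    assume "(LINT x|P \<theta>. (x - deriv A \<theta>)\<^sup>2) = 0"
    hence "AE x in P \<theta>. x = deriv A \<theta>"
      using integral_nonneg_eq_0_iff_AE[OF integrable_centred_power[OF \<theta>, of _ 2]] by simp
    hence "AE x in \<mu>. x = deriv A \<theta>"
      unfolding exp_fam_def by (subst (asm) AE_density) auto
    with not_AE_eq show False by blast
  qed
  thus ?thesis using \<theta> by (simp add: deriv2_A less_le)
qed

text \<open>Monotone likelihood ratio: the two densities cross once, and on either side of the
  crossing their difference has the same sign as the deviation of \<open>f\<close> from its value
  there. That value drops out on integration because both densities have mass one.\<close>

lemma integral_P_mono_param:
  fixes f :: "real \<Rightarrow> real"
  assumes le: "a \<le> b" and ab: "a \<in> \<Theta>" "b \<in> \<Theta>"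
    and f[measurable]: "f \<in> borel_measurable borel" and mono: "mono f"
    and bounded: "\<And>x. \<bar>f x\<bar> \<le> B"
  shows "(LINT x|P a. f x) \<le> (LINT x|P b. f x)"
proof (cases "a = b")
  case False
  with le have "a < b" by simp
  \<comment> \<open>The crossing point, obtained by equating the exponents a x - A(a) and b x -
    A(b).\<close>
  define c where "c = (A b - A a) / (b - a)"
  define p where "p t x = exp (t * x - A t)" for t x
  have p1: "integrable \<mu> (p t)" "(LINT x|\<mu>. p t x) = 1" if "t \<in> \<Theta>" for t
    using integrable_exp[OF that] partition_pos[OF that] by (simp_all add: p_def[abs_def] exp_diff exp_A[OF that])
  have fp: "integrable \<mu> (\<lambda>x. f x * p t x)" if "t \<in> \<Theta>" for t
  proof (rule Bochner_Integration.integrable_bound[OF integrable_mult_right[OF p1(1)[OF that], of B]])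
    show "AE x in \<mu>. norm (f x * p t x) \<le> norm (B * p t x)"
      using bounded by (intro AE_I2) (fastforce simp: abs_mult p_def intro!: mult_right_mono order_trans[OF _ abs_ge_self])
  qed (simp add: p_def)
  have "0 \<le> (LINT x|\<mu>. (f x - f c) * (p b x - p a x))"
  proof (rule Bochner_Integration.integral_nonneg)
    fix x
    show "0 \<le> (f x - f c) * (p b x - p a x)"
    proof (cases "x \<ge> c")
      case True
      hence "b * x - A b \<ge> a * x - A a" using \<open>a < b\<close> by (simp add: c_def field_simps)
      thus ?thesis using monoD[OF mono True] by (simp add: p_def)
    next
      case False
      hence "b * x - A b \<le> a * x - A a" using \<open>a < b\<close> by (simp add: c_def field_simps)
      thus ?thesis using monoD[OF mono, of x c] False by (intro mult_nonpos_nonpos) (simp_all add: p_def)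
    qed
  qed
  also have "\<dots> = (LINT x|\<mu>. (f x * p b x - f x * p a x) - (f c * p b x - f c * p a x))"
    by (simp add: algebra_simps)
  also have "\<dots> = (LINT x|\<mu>. f x * p b x) - (LINT x|\<mu>. f x * p a x)"
    using p1 fp ab by simp
  finally show ?thesis by (simp add: integral_P p_def)
qed simp

text \<open>Two mean value steps, first for the increment of A over length \<open>h\<close>, then
  for A'. This second difference is the logarithm of the second moment of the likelihood
  ratio.\<close>

lemma second_difference_A_le:
  assumes h: "h > 0" and sub: "{\<theta>..\<theta> + 2 * h} \<subseteq> interior \<Theta>"
    and K: "\<And>t. t \<in> {\<theta>..\<theta> + 2 * h} \<Longrightarrow> deriv (deriv A) t \<le> K"
  shows "A (\<theta> + 2 * h) - 2 * A (\<theta> + h) + A \<theta> \<le> h\<^sup>2 * K"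
proof -
  have D1: "(A has_real_derivative deriv A t) (at t)" if "t \<in> {\<theta>..\<theta> + 2 * h}" for t
    using A_has_derivative[of t] sub that by (auto simp: deriv_A)
  have D2: "(deriv A has_real_derivative deriv (deriv A) t) (at t)" if "t \<in> {\<theta>..\<theta> + 2 * h}" for t
    using deriv_A_has_derivative[of t] sub that by (auto simp: deriv2_A)
  have "((\<lambda>t. A (t + h) - A t) has_real_derivative deriv A (t + h) - deriv A t) (at t)"
    if "\<theta> \<le> t" "t \<le> \<theta> + h" for t
    using that h D1[of t] D1[of "t + h"] by (auto intro!: derivative_eq_intros DERIV_shift[THEN iffD1])
  from MVT2[OF _ this, of \<theta> "\<theta> + h"] h obtain z where z: "\<theta> < z" "z < \<theta> + h"
      "(A (\<theta> + h + h) - A (\<theta> + h)) - (A (\<theta> + h) - A \<theta>) = h * (deriv A (z + h) - deriv A z)"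
    by auto
  from MVT2[of z "z + h" "deriv A" "deriv (deriv A)"] D2 z h obtain w
    where w: "z < w" "w < z + h" "deriv A (z + h) - deriv A z = h * deriv (deriv A) w"
    by auto
  have "A (\<theta> + 2 * h) - 2 * A (\<theta> + h) + A \<theta> = h\<^sup>2 * deriv (deriv A) w"
    using z(3) w(3) by (simp add: power2_eq_square algebra_simps)
  also have "\<dots> \<le> h\<^sup>2 * K" using w z by (intro mult_left_mono K) auto
  finally show ?thesis .
qed

lemma P_eq_density:
  "P t = density (P \<theta>) (\<lambda>x. ennreal (exp ((t - \<theta>) * x - (A t - A \<theta>))))"
  unfolding exp_fam_def
  by (subst density_density_eq) (auto intro!: density_cong simp: algebra_simps simp flip: exp_add ennreal_mult)

text \<open>Squaring the ratio tilts the density at \<theta> by \<open>2 * h\<close>, so the second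
  moment is again a quotient of partition functions, finite because \<theta> + 2h is a natural
  parameter.\<close>

lemma
  assumes "\<theta> \<in> \<Theta>" "\<theta> + 2 * h \<in> \<Theta>"
  shows integrable_square_likelihood_ratio:
      "integrable (P \<theta>) (\<lambda>x. (exp (h * x - (A (\<theta> + h) - A \<theta>)))\<^sup>2)" (is "integrable _ ?f")
    and integral_square_likelihood_ratio:
      "(LINT x|P \<theta>. (exp (h * x - (A (\<theta> + h) - A \<theta>)))\<^sup>2) =
         exp (A (\<theta> + 2 * h) - 2 * A (\<theta> + h) + A \<theta>)"
proof -
  have eq: "?f x * exp (\<theta> * x) = exp ((\<theta> + 2 * h) * x) * exp (2 * A \<theta> - 2 * A (\<theta> + h))" for x
    by (simp add: power2_eq_square algebra_simps flip: exp_add)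
  show "integrable (P \<theta>) ?f"
    unfolding eq by (subst integrable_P_iff) (auto simp: eq integrable_exp assms)
  have "(LINT x|P \<theta>. ?f x) = exp (A (\<theta> + 2 * h)) * exp (2 * A \<theta> - 2 * A (\<theta> + h)) / exp (A \<theta>)"
    using assms by (simp add: integral_P_quotient eq exp_A)
  also have "\<dots> = exp (A (\<theta> + 2 * h) - 2 * A (\<theta> + h) + A \<theta>)"
    by (simp add: algebra_simps flip: exp_add exp_diff)
  finally show "(LINT x|P \<theta>. ?f x) = exp (A (\<theta> + 2 * h) - 2 * A (\<theta> + h) + A \<theta>)" .
qed

end

section \<open>The clamped statistic and the growth of its mean\<close>

definition clamp01 :: "real \<Rightarrow> real \<Rightarrow> real" where
  "clamp01 R y = (max (- R) (min R y) + R) / (2 * R)"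

lemma clamp01_measurable [measurable]: "clamp01 R \<in> borel_measurable borel"
  unfolding clamp01_def[abs_def] by measurable

text \<open>The unit range limits the influence of one record on a sum of such values to one, which
  is what privacy of the test rests on.\<close>

lemma clamp01_range: "R > 0 \<Longrightarrow> clamp01 R y \<in> {0..1}"
  by (auto simp: clamp01_def field_simps)

lemma mono_clamp01: "R > 0 \<Longrightarrow> mono (clamp01 R)"
  by (auto simp: clamp01_def mono_def intro!: divide_right_mono)

text \<open>Undoing the rescaling leaves the truncation of u + d to [-R, R]. Where truncation acts,
  |u| is at least R - 1, and the loss of at most u^2 is absorbed by the quartic term. The offset
  \<open>d\<close> allows for a clamp that is not centred at the mean.\<close>

lemma mult_clamp_ge:
  fixes u d R :: real
  assumes "R > 1" "\<bar>d\<bar> \<le> 1"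
  shows "u * (2 * R * clamp01 R (u + d) - R) \<ge> u\<^sup>2 + u * d - u ^ 4 / (R - 1)\<^sup>2"
proof -
  define c where "c = max (- R) (min R (u + d))"
  have eq: "2 * R * clamp01 R (u + d) - R = c" using assms by (simp add: clamp01_def c_def)
  show ?thesis
  proof (cases "\<bar>u + d\<bar> \<le> R")
    case True
    hence "c = u + d" by (auto simp: c_def)
    moreover have "0 \<le> u ^ 4 / (R - 1)\<^sup>2" by simp
    ultimately show ?thesis unfolding eq by (simp add: power2_eq_square[of u] distrib_left)
  next
    case False
    hence c: "u + d > R \<and> c = R \<or> u + d < - R \<and> c = - R"
      using assms by (auto simp: c_def)
    hence u: "\<bar>u\<bar> \<ge> R - 1" using assms by linarith
    have "u * (u + d - c) \<le> u * u"
    proof (cases "u + d > R")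
      case True
      hence "u > 0" "d - c \<le> 0" using c assms by linarith+
      thus ?thesis by (simp add: mult_left_mono)
    next
      case False
      hence "u < 0" "d - c \<ge> 0" using c assms by linarith+
      thus ?thesis by (simp add: mult_left_mono_neg)
    qed
    also have "\<dots> = u\<^sup>2 * (R - 1)\<^sup>2 / (R - 1)\<^sup>2" using assms by (simp add: power2_eq_square)
    also have "\<dots> \<le> u\<^sup>2 * u\<^sup>2 / (R - 1)\<^sup>2"
      using u assms by (intro divide_right_mono mult_left_mono) (auto simp: abs_le_square_iff[symmetric])
    finally show ?thesis unfolding eq by (simp add: power2_eq_square power4_eq_xxxx algebra_simps)
  qed
qed

context exponential_family
begin

text \<open>The mean value theorem reduces the gap to a covariance at one intermediate parameter.
  Integrating \<open>mult_clamp_ge\<close> bounds that covariance below by a variance term minus a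
  fourth moment term, and \<open>4 * \<zeta> \<le> (R - 1)\<^sup>2\<close> keeps the latter below
  half of the former.\<close>

lemma mean_clamp_gap:
  fixes m s R \<zeta> :: real
  assumes ab: "a < b" "{a..b} \<subseteq> interior \<Theta>" and s: "s > 0" and R: "R > 1" "4 * \<zeta> \<le> (R - 1)\<^sup>2"
    and mean: "\<And>t. t \<in> {a..b} \<Longrightarrow> \<bar>deriv A t - m\<bar> \<le> s"
    and var: "\<And>t. t \<in> {a..b} \<Longrightarrow> deriv (deriv A) t \<in> {s\<^sup>2 / 2..2 * s\<^sup>2}"
    and mom4: "\<And>t. t \<in> {a..b} \<Longrightarrow>
        (LINT x|P t. (x - deriv A t) ^ 4) / (deriv (deriv A) t)\<^sup>2 \<le> \<zeta>"
  shows "(b - a) * s / (8 * R) \<le>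
     (LINT x|P b. clamp01 R ((x - m) / s)) - (LINT x|P a. clamp01 R ((x - m) / s))"
proof -
  define g where "g x = clamp01 R ((x - m) / s)" for x
  have g[measurable]: "g \<in> borel_measurable borel" by (simp add: g_def[abs_def])
  have int_g: "integrable (P t) g" if "t \<in> interior \<Theta>" for t
  proof -
    interpret prob_space "P t" by (rule prob_space_P[OF interior_nat_paramsD[OF that]])
    show ?thesis using clamp01_range[of R] R
      by (intro integrable_const_bound[where B = 1]) (auto simp: g_def)
  qed
  have "((\<lambda>t. LINT x|P t. g x) has_real_derivative (LINT x|P t. (x - deriv A t) * g x)) (at t)"
    if "a \<le> t" "t \<le> b" for t
    using that ab by (intro mean_has_derivative(2) int_g) auto
  from MVT2[OF ab(1) this] obtain z where z: "a < z" "z < b"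
    and eq: "(LINT x|P b. g x) - (LINT x|P a. g x) = (b - a) * (LINT x|P z. (x - deriv A z) * g x)"
    by auto
  have zI: "z \<in> interior \<Theta>" and zab: "z \<in> {a..b}" using z ab by auto
  define mz where "mz = deriv A z"
  define v where "v = deriv (deriv A) z"
  define M4 where "M4 = (LINT x|P z. (x - mz) ^ 4)"
  have v: "s\<^sup>2 / 2 \<le> v" "v \<le> 2 * s\<^sup>2" using var[OF zab] by (auto simp: v_def)
  have "v > 0" using deriv2_A_pos[OF zI] by (simp add: v_def)
  have M4: "M4 \<le> \<zeta> * v\<^sup>2"
    using mom4[OF zab] \<open>v > 0\<close> by (simp add: M4_def mz_def v_def field_simps)
  have int1: "integrable (P z) (\<lambda>x. x - mz)" using integrable_centred_power[OF zI, of mz 1] by simp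
  note int2 = integrable_centred_power[OF zI, of mz 2]
  note int4 = integrable_centred_power[OF zI, of mz 4]
  have int_xg: "integrable (P z) (\<lambda>x. (x - mz) * g x)"
    using mean_has_derivative(1)[OF g int_g zI] int_g[OF zI] by (simp add: left_diff_distrib)
  \<comment> \<open>The middle summand is linear in the centred variable and integrates to zero. Its
    coefficient holds the offset of the clamp and the shift by \<open>R\<close> from the
    rescaling.\<close>
  have "v / s - M4 / (s ^ 3 * (R - 1)\<^sup>2) =
     (LINT x|P z. (x - mz)\<^sup>2 / s + (x - mz) * ((mz - m) / s + R) - (x - mz) ^ 4 / (s ^ 3 * (R - 1)\<^sup>2))"
    using int1 int2 int4 integral_centred[OF zI]
    by (simp add: v_def M4_def mz_def deriv2_A[OF zI])
  also have "\<dots> \<le> (LINT x|P z. 2 * R * ((x - mz) * g x))"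
  proof (rule integral_mono)
    fix x
    define u where "u = (x - mz) / s"
    define d where "d = (mz - m) / s"
    have d: "\<bar>d\<bar> \<le> 1" using mean[OF zab] s by (simp add: d_def mz_def abs_divide)
    have x: "x - mz = s * u" using s by (simp add: u_def)
    have gx: "g x = clamp01 R (u + d)" using s by (simp add: g_def u_def d_def add_divide_distrib[symmetric])
    have "s * (u\<^sup>2 + u * d - u ^ 4 / (R - 1)\<^sup>2) \<le> s * (u * (2 * R * g x - R))"
      unfolding gx using s by (intro mult_left_mono mult_clamp_ge R d) auto
    moreover have "s * (u\<^sup>2 + u * d - u ^ 4 / (R - 1)\<^sup>2) =
       (x - mz)\<^sup>2 / s + (x - mz) * d - (x - mz) ^ 4 / (s ^ 3 * (R - 1)\<^sup>2)"
    proof -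
      have "s * (u\<^sup>2 + u * d - u ^ 4 / Q) = (s * u)\<^sup>2 / s + s * u * d - (s * u) ^ 4 / (s ^ 3 * Q)"
        if "Q > 0" for Q
        using s that by (simp add: field_simps power2_eq_square power3_eq_cube power4_eq_xxxx)
      from this[of "(R - 1)\<^sup>2"] show ?thesis using R by (simp add: x)
    qed
    ultimately show "(x - mz)\<^sup>2 / s + (x - mz) * ((mz - m) / s + R) - (x - mz) ^ 4 / (s ^ 3 * (R - 1)\<^sup>2)
        \<le> 2 * R * ((x - mz) * g x)"
      unfolding d_def[symmetric] by (simp add: x algebra_simps)
  qed (use int1 int2 int4 int_xg in \<open>auto intro!: Bochner_Integration.integrable_add Bochner_Integration.integrable_diff\<close>)
  also have "\<dots> = 2 * R * (LINT x|P z. (x - mz) * g x)" by simp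
  finally have 1: "v / s - M4 / (s ^ 3 * (R - 1)\<^sup>2) \<le> 2 * R * (LINT x|P z. (x - mz) * g x)" .
  have "M4 / (s ^ 3 * (R - 1)\<^sup>2) \<le> \<zeta> * v\<^sup>2 / (s ^ 3 * (R - 1)\<^sup>2)"
    using M4 s by (intro divide_right_mono) auto
  \<comment> \<open>One of the two factors \<open>v\<close> is replaced by its upper bound 2 s^2,
    the other is kept so that the loss comes out as half of v / s.\<close>
  also have "\<dots> \<le> ((R - 1)\<^sup>2 / 4) * (v * (2 * s\<^sup>2)) / (s ^ 3 * (R - 1)\<^sup>2)"
    using R v s \<open>v > 0\<close> by (intro divide_right_mono mult_mono) (auto simp: power2_eq_square)
  also have "\<dots> = v / (2 * s)"
  proof -
    have "Q / 4 * (v * (2 * s\<^sup>2)) / (s ^ 3 * Q) = v / (2 * s)" if "Q > 0" for Q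
      using s that by (simp add: field_simps power2_eq_square power3_eq_cube)
    from this[of "(R - 1)\<^sup>2"] R show ?thesis by simp
  qed
  finally have "v / s - v / (2 * s) \<le> 2 * R * (LINT x|P z. (x - mz) * g x)" using 1 by linarith
  moreover have "v / s - v / (2 * s) \<ge> s / 4" using v s by (simp add: field_simps power2_eq_square)
  ultimately have "s / 4 \<le> 2 * R * (LINT x|P z. (x - mz) * g x)" by linarith
  hence "s / (8 * R) \<le> (LINT x|P z. (x - mz) * g x)" using R by (simp add: field_simps)
  hence "(b - a) * (s / (8 * R)) \<le> (b - a) * (LINT x|P z. (x - mz) * g x)"
    using ab by (intro mult_left_mono) auto
  thus ?thesis using eq by (simp add: g_def mz_def)
qed

end

section \<open>Le Cam's two-point bound\<close>

lemma prob_space_sample_bind: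
  assumes P: "prob_space P" "sets P = sets borel" and M: "M \<in> estimators n"
  shows "prob_space ((\<Pi>\<^sub>M i\<in>{..<n}. P) \<bind> M)"
    and "sets ((\<Pi>\<^sub>M i\<in>{..<n}. P) \<bind> M) = sets borel"
    and "E \<in> sets borel \<Longrightarrow> measure ((\<Pi>\<^sub>M i\<in>{..<n}. P) \<bind> M) E =
           (LINT d|(\<Pi>\<^sub>M i\<in>{..<n}. P). measure (M d) E)"
    and "E \<in> sets borel \<Longrightarrow> integrable (\<Pi>\<^sub>M i\<in>{..<n}. P) (\<lambda>d. measure (M d) E)"
proof -
  interpret prob_space "\<Pi>\<^sub>M i\<in>{..<n}. P" by (intro prob_space_PiM P)
  have "sets (\<Pi>\<^sub>M i\<in>{..<n}. P) = sets (\<Pi>\<^sub>M i\<in>{..<n}. (borel :: real measure))"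
    by (intro sets_PiM_cong) (auto simp: P)
  hence M': "M \<in> (\<Pi>\<^sub>M i\<in>{..<n}. P) \<rightarrow>\<^sub>M prob_algebra borel"
    using M by (simp add: estimators_def cong: measurable_cong_sets)
  note Ms = measurable_prob_algebraD[OF M']
  show "prob_space ((\<Pi>\<^sub>M i\<in>{..<n}. P) \<bind> M)"
    using measurable_space[OF M'] by (intro prob_space_bind[OF AE_I2 Ms]) (auto simp: space_prob_algebra)
  show "sets ((\<Pi>\<^sub>M i\<in>{..<n}. P) \<bind> M) = sets borel"
    by (intro sets_bind[where N = borel] not_empty) (use sets_kernel[OF Ms] in auto)
  show "measure ((\<Pi>\<^sub>M i\<in>{..<n}. P) \<bind> M) E = (LINT d|(\<Pi>\<^sub>M i\<in>{..<n}. P). measure (M d) E)"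
    if "E \<in> sets borel"
    by (rule measure_bind[OF Ms that])
  show "integrable (\<Pi>\<^sub>M i\<in>{..<n}. P) (\<lambda>d. measure (M d) E)" if "E \<in> sets borel"
  proof (rule integrable_const_bound[where B = 1])
    show "AE d in (\<Pi>\<^sub>M i\<in>{..<n}. P). norm (measure (M d) E) \<le> 1"
      using measurable_space[OF M'] by (intro AE_I2) (simp add: space_prob_algebra prob_space.prob_le_1)
    show "(\<lambda>d. measure (M d) E) \<in> borel_measurable (\<Pi>\<^sub>M i\<in>{..<n}. P)"
      by (rule measurable_compose[OF M' measurable_measure_prob_algebra[OF that]])
  qed
qed

lemma interval_borel [measurable, simp]: "{y::real. \<bar>y - c\<bar> \<le> r} \<in> sets borel"
  by measurable

lemma risk_le:
  assumes "0 \<le> r" "3/4 \<le> measure ((\<Pi>\<^sub>M i\<in>{..<n}. P) \<bind> M) {y. \<bar>y - stat P\<bar> \<le> r}"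
  shows "risk n stat P M \<le> r"
  unfolding risk_def using assms by (intro cInf_lower bdd_belowI[where m = 0]) auto

text \<open>An infimum below \<open>s\<close> yields an admissible radius only if some radius is
  admissible. Intervals of integer radius exhaust the line, so their probability tends to one and
  eventually exceeds 3/4.\<close>

lemma risk_less_witness:
  assumes P: "prob_space P" "sets P = sets borel" and M: "M \<in> estimators n"
    and less: "risk n stat P M < s"
  obtains r where "r < s" "3/4 \<le> measure ((\<Pi>\<^sub>M i\<in>{..<n}. P) \<bind> M) {y. \<bar>y - stat P\<bar> \<le> r}"
proof -
  define B where "B = (\<Pi>\<^sub>M i\<in>{..<n}. P) \<bind> M"
  interpret B: prob_space B unfolding B_def by (rule prob_space_sample_bind[OF P M])
  have sets_B[simp]: "sets B = sets borel" unfolding B_def by (rule prob_space_sample_bind[OF P M])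
  have space_B: "space B = UNIV" using sets_eq_imp_space_eq[OF sets_B] by simp
  have "(\<lambda>k. measure B {y. \<bar>y - stat P\<bar> \<le> real k}) \<longlonglongrightarrow> measure B (\<Union>k. {y. \<bar>y - stat P\<bar> \<le> real k})"
    by (intro B.finite_Lim_measure_incseq) (auto simp: incseq_def)
  also have "(\<Union>k. {y. \<bar>y - stat P\<bar> \<le> real k}) = space B"
    using real_arch_simple by (auto simp: space_B)
  finally have "(\<lambda>k. measure B {y. \<bar>y - stat P\<bar> \<le> real k}) \<longlonglongrightarrow> 1"
    by (simp add: B.prob_space)
  hence "eventually (\<lambda>k. measure B {y. \<bar>y - stat P\<bar> \<le> real k} > 3/4) sequentially"
    by (rule order_tendstoD) simp
  then obtain k where k: "measure B {y. \<bar>y - stat P\<bar> \<le> real k} > 3/4"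
    using eventually_happens'[OF sequentially_bot] by blast
  define S where "S = {r. 0 \<le> r \<and> 3/4 \<le> measure B {y. \<bar>y - stat P\<bar> \<le> r}}"
  have "S \<noteq> {}" using less_imp_le[OF k] unfolding S_def by (auto intro!: exI[of _ "real k"])
  moreover have "Inf S < s" using less by (simp add: risk_def S_def B_def)
  ultimately obtain r where "r \<in> S" "r < s" by (rule cInf_lessD[THEN bexE])
  thus ?thesis using that by (simp add: S_def B_def)
qed

text \<open>A product measure is determined by its values on boxes, and there the density times the
  indicator factorises over the coordinates.\<close>

lemma PiM_density:
  assumes I: "finite I" and P: "prob_space P" and f[measurable]: "f \<in> borel_measurable P"
    and D: "prob_space (density P f)"
  shows "PiM I (\<lambda>_. density P f) = density (PiM I (\<lambda>_. P)) (\<lambda>x. \<Prod>i\<in>I. f (x i) :: ennreal)"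
proof -
  interpret P: product_prob_space "\<lambda>_. P" I by (intro product_prob_spaceI P)
  interpret D: product_prob_space "\<lambda>_. density P f" I by (intro product_prob_spaceI D)
  show ?thesis
  proof (rule D.PiM_eqI[OF I, symmetric])
    show "sets (density (PiM I (\<lambda>_. P)) (\<lambda>x. \<Prod>i\<in>I. f (x i))) = sets (PiM I (\<lambda>_. density P f))"
      unfolding sets_density by (intro sets_PiM_cong) auto
    fix A assume A: "\<And>i. i \<in> I \<Longrightarrow> A i \<in> sets (density P f)"
    have "emeasure (density (PiM I (\<lambda>_. P)) (\<lambda>x. \<Prod>i\<in>I. f (x i))) (Pi\<^sub>E I A) =
        (\<integral>\<^sup>+x. (\<Prod>i\<in>I. f (x i)) * indicator (Pi\<^sub>E I A) x \<partial>PiM I (\<lambda>_. P))"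
      using A I by (intro emeasure_density) (auto intro!: sets_PiM_I_finite)
    also have "\<dots> = (\<integral>\<^sup>+x. (\<Prod>i\<in>I. f (x i) * indicator (A i) (x i)) \<partial>PiM I (\<lambda>_. P))"
    proof (intro nn_integral_cong)
      fix x assume "x \<in> space (PiM I (\<lambda>_. P))"
      hence "x \<in> extensional I" by (auto simp: space_PiM PiE_def)
      hence "x \<in> Pi\<^sub>E I A \<longleftrightarrow> (\<forall>i\<in>I. x i \<in> A i)" by (auto simp: PiE_def)
      hence "(indicator (Pi\<^sub>E I A) x :: ennreal) = (\<Prod>i\<in>I. indicator (A i) (x i))"
        using I by (auto simp: indicator_def prod_zero_iff)
      thus "(\<Prod>i\<in>I. f (x i)) * indicator (Pi\<^sub>E I A) x = (\<Prod>i\<in>I. f (x i) * indicator (A i) (x i))"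
        by (simp add: prod.distrib)
    qed
    also have "\<dots> = (\<Prod>i\<in>I. \<integral>\<^sup>+x. f x * indicator (A i) x \<partial>P)"
      using A by (intro P.product_nn_integral_prod I) auto
    also have "\<dots> = (\<Prod>i\<in>I. emeasure (density P f) (A i))"
      using A by (intro prod.cong refl) (simp add: emeasure_density)
    finally show "emeasure (density (PiM I (\<lambda>_. P)) (\<lambda>x. \<Prod>i\<in>I. f (x i))) (Pi\<^sub>E I A) =
        (\<Prod>i\<in>I. emeasure (density P f) (A i))" .
  qed
qed

text \<open>The step from the second moment of the likelihood ratio \<open>L\<close> to total variation is
  \<open>\<bar>L - 1\<bar> \<le> (L - 1)\<^sup>2 + 1/4\<close>.\<close>

lemma sample_bind_diff_less:
  fixes l :: "real \<Rightarrow> real"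
  assumes P: "prob_space P" "sets P = sets borel"
    and l[measurable]: "l \<in> borel_measurable borel" "\<And>x. l x \<ge> 0"
    and Q: "prob_space Q" "Q = density P (\<lambda>x. ennreal (l x))"
    and l2: "integrable P (\<lambda>x. (l x)\<^sup>2)" "(LINT x|P. (l x)\<^sup>2) ^ n < 5/4"
    and M: "M \<in> estimators n" and E: "E \<in> sets borel"
  shows "measure ((\<Pi>\<^sub>M i\<in>{..<n}. P) \<bind> M) E - measure ((\<Pi>\<^sub>M i\<in>{..<n}. Q) \<bind> M) E < 1/2"
proof -
  let ?P = "\<Pi>\<^sub>M i\<in>{..<n}. P" and ?Q = "\<Pi>\<^sub>M i\<in>{..<n}. Q"
  interpret Pn: prob_space ?P by (intro prob_space_PiM P)
  interpret PP: product_prob_space "\<lambda>_. P" "{..<n}" by (intro product_prob_spaceI P)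
  interpret QQ: product_prob_space "\<lambda>_. Q" "{..<n}" by (intro product_prob_spaceI Q)
  have lP[measurable]: "l \<in> borel_measurable P" using l P(2) by (simp cong: measurable_cong_sets)
  define L where "L x = (\<Prod>i\<in>{..<n}. l (x i))" for x
  have L[measurable]: "L \<in> borel_measurable ?P" unfolding L_def[abs_def] by measurable
  have L0: "L x \<ge> 0" for x unfolding L_def by (intro prod_nonneg) (simp add: l)
  have dens: "?Q = density ?P (\<lambda>x. ennreal (L x))"
    using PiM_density[OF finite_lessThan P(1), of "\<lambda>x. ennreal (l x)" n] Q
    by (simp add: L_def prod_ennreal l)
  have sets_P: "sets ?P = sets (\<Pi>\<^sub>M i\<in>{..<n}. (borel :: real measure))"
    by (intro sets_PiM_cong) (auto simp: P)
  define \<phi> where "\<phi> d = measure (M d) E" for d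
  have Mm: "M \<in> ?P \<rightarrow>\<^sub>M prob_algebra borel"
    using M sets_P by (simp add: estimators_def cong: measurable_cong_sets)
  have \<phi>[measurable]: "\<phi> \<in> borel_measurable ?P"
    unfolding \<phi>_def[abs_def] by (rule measurable_compose[OF Mm measurable_measure_prob_algebra[OF E]])
  have \<phi>01: "0 \<le> \<phi> d" "\<phi> d \<le> 1" if "d \<in> space ?P" for d
  proof -
    interpret prob_space "M d" using measurable_space[OF Mm that] by (simp add: space_prob_algebra)
    show "0 \<le> \<phi> d" "\<phi> d \<le> 1" by (auto simp: \<phi>_def)
  qed
  have "(\<integral>\<^sup>+x. ennreal (L x) \<partial>?P) = emeasure ?Q (space ?Q)"
    unfolding dens by (simp add: emeasure_density cong: nn_integral_cong)
  hence nn_L: "(\<integral>\<^sup>+x. ennreal (L x) \<partial>?P) = ennreal 1" by (simp add: QQ.emeasure_space_1)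
  have int_L: "integrable ?P L" "(LINT x|?P. L x) = 1"
    using nn_integral_eq_integrable[OF L, of 1] L0 nn_L by auto
  have L2: "(L x)\<^sup>2 = (\<Prod>i\<in>{..<n}. (l (x i))\<^sup>2)" for x
    by (simp add: L_def prod_power_distrib)
  have int_L2: "integrable ?P (\<lambda>x. (L x)\<^sup>2)"
    unfolding L2 by (intro PP.product_integrable_prod l2) auto
  have "(LINT x|?P. (L x)\<^sup>2) = (\<Prod>i\<in>{..<n}. LINT x|P. (l x)\<^sup>2)"
    unfolding L2 by (intro PP.product_integral_prod l2) auto
  hence L2_less: "(LINT x|?P. (L x)\<^sup>2) < 5/4" using l2 by simp
  have int_\<phi>: "integrable ?P \<phi>"
    unfolding \<phi>_def[abs_def] by (rule prob_space_sample_bind(4)[OF P M E])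
  have int_L\<phi>: "integrable ?P (\<lambda>x. L x * \<phi> x)"
    by (rule Bochner_Integration.integrable_bound[OF int_L(1)])
       (use \<phi>01 L0 in \<open>auto simp: abs_mult mult_left_le\<close>)
  have "measure (?P \<bind> M) E - measure (?Q \<bind> M) E = (LINT x|?P. \<phi> x) - (LINT x|?P. L x * \<phi> x)"
  proof -
    have "sets Q = sets borel" using P Q by simp
    from prob_space_sample_bind(3)[OF Q(1) this M E] prob_space_sample_bind(3)[OF P M E]
    show ?thesis by (simp add: dens integral_density L0 flip: \<phi>_def)
  qed
  also have "\<dots> = (LINT x|?P. \<phi> x - L x * \<phi> x)"
    using int_\<phi> int_L\<phi> by simp
  also have "\<dots> \<le> (LINT x|?P. ((L x)\<^sup>2 - 2 * L x) + 5/4)"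
  proof (intro integral_mono)
    fix x assume x: "x \<in> space ?P"
    have "\<phi> x - L x * \<phi> x = \<phi> x * (1 - L x)" by (simp add: algebra_simps)
    also have "\<dots> \<le> 1 * \<bar>1 - L x\<bar>"
      using \<phi>01[OF x] by (intro order_trans[OF mult_left_mono[OF abs_ge_self] mult_right_mono]) auto
    also have "\<dots> \<le> (L x)\<^sup>2 - 2 * L x + 5/4"
      using zero_le_power2[of "\<bar>1 - L x\<bar> - 1/2"] by (simp add: power2_eq_square abs_if algebra_simps split: if_splits)
    finally show "\<phi> x - L x * \<phi> x \<le> (L x)\<^sup>2 - 2 * L x + 5/4" .
  qed (use int_L int_L2 int_\<phi> int_L\<phi> in auto)
  \<comment> \<open>As \<open>L\<close> has mean one, the bound is the second moment minus 3/4; the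
    threshold 5/4 is chosen to bring this below 1/2.\<close>
  also have "\<dots> = (LINT x|?P. (L x)\<^sup>2) - 2 + 5/4"
    using int_L int_L2 by (simp add: Pn.prob_space)
  also have "\<dots> < 1/2" using L2_less by simp
  finally show ?thesis .
qed

text \<open>If both risks were below half the distance, two disjoint intervals would each have
  probability at least 3/4 under their own law. The first would then have at most 1/4 under the
  other law, a difference of at least 1/2, contradicting
  \<open>sample_bind_diff_less\<close>.\<close>

lemma two_point_lower_bound:
  fixes l :: "real \<Rightarrow> real"
  assumes P: "prob_space P" "sets P = sets borel"
    and l: "l \<in> borel_measurable borel" "\<And>x. l x \<ge> 0"
    and Q: "prob_space Q" "Q = density P (\<lambda>x. ennreal (l x))"
    and l2: "integrable P (\<lambda>x. (l x)\<^sup>2)" "(LINT x|P. (l x)\<^sup>2) ^ n < 5/4"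
    and M: "M \<in> estimators n"
  shows "\<bar>stat P - stat Q\<bar> / 2 \<le> max (risk n stat P M) (risk n stat Q M)"
proof (rule ccontr)
  assume "\<not> ?thesis"
  hence less: "risk n stat P M < \<bar>stat P - stat Q\<bar> / 2" "risk n stat Q M < \<bar>stat P - stat Q\<bar> / 2"
    by auto
  have sQ: "sets Q = sets borel" using P Q by simp
  obtain r where r: "r < \<bar>stat P - stat Q\<bar> / 2"
    "3/4 \<le> measure ((\<Pi>\<^sub>M i\<in>{..<n}. P) \<bind> M) {y. \<bar>y - stat P\<bar> \<le> r}" (is "_ \<le> measure _ ?E")
    by (rule risk_less_witness[OF P M less(1)])
  obtain r' where r': "r' < \<bar>stat P - stat Q\<bar> / 2"
    "3/4 \<le> measure ((\<Pi>\<^sub>M i\<in>{..<n}. Q) \<bind> M) {y. \<bar>y - stat Q\<bar> \<le> r'}" (is "_ \<le> measure ?Q ?E'")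
    by (rule risk_less_witness[OF Q(1) sQ M less(2)])
  interpret Q: prob_space ?Q by (rule prob_space_sample_bind[OF Q(1) sQ M])
  have sets_Q: "sets ?Q = sets borel" by (rule prob_space_sample_bind[OF Q(1) sQ M])
  have "?E \<inter> ?E' = {}" using r(1) r'(1) by auto
  hence "measure ?Q ?E + measure ?Q ?E' = measure ?Q (?E \<union> ?E')"
    by (intro Q.finite_measure_Union[symmetric]) (auto simp: sets_Q)
  also have "\<dots> \<le> 1" by (rule Q.prob_le_1)
  finally have "measure ((\<Pi>\<^sub>M i\<in>{..<n}. P) \<bind> M) ?E - measure ?Q ?E \<ge> 1/2" using r r' by linarith
  moreover have "measure ((\<Pi>\<^sub>M i\<in>{..<n}. P) \<bind> M) ?E - measure ?Q ?E < 1/2"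
    by (rule sample_bind_diff_less[OF P l Q l2 M]) simp
  ultimately show False by linarith
qed

section \<open>Private tests\<close>

definition logistic :: "real \<Rightarrow> real" where "logistic t = 1 / (1 + exp (- t))"

lemma logistic_measurable [measurable]: "logistic \<in> borel_measurable borel"
  unfolding logistic_def[abs_def] by measurable

lemma logistic_range: "0 \<le> logistic t" "logistic t \<le> 1"
proof -
  have "1 + exp (- t) > 0" by (simp add: add_pos_pos)
  thus "0 \<le> logistic t" "logistic t \<le> 1" by (auto simp: logistic_def field_simps)
qed

text \<open>This symmetry carries privacy and error bounds for one outcome of the test over to the
  other.\<close>

lemma logistic_minus: "logistic (- t) = 1 - logistic t"
proof -
  have "1 + exp t > 0" by (simp add: add_pos_pos)
  thus ?thesis by (simp add: logistic_def exp_minus field_simps)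
qed

lemma logistic_le_exp: "logistic t \<le> exp t"
proof -
  have "logistic t = exp t / (exp t + 1)"
    by (simp add: logistic_def exp_minus field_simps)
  also have "\<dots> \<le> exp t / 1" by (intro divide_left_mono) (auto simp: add_pos_pos)
  finally show ?thesis by simp
qed

text \<open>Multiplicative form of the 1-Lipschitz property of the logarithm of
  \<open>logistic\<close>, by comparing denominators.\<close>

lemma logistic_le_exp_mult:
  assumes "\<bar>s - t\<bar> \<le> e" shows "logistic s \<le> exp e * logistic t"
proof -
  have "1 + exp (- t) \<le> exp e + exp (e - s)"
    using assms by (intro add_mono) auto
  also have "\<dots> = exp e * (1 + exp (- s))" by (simp add: algebra_simps flip: exp_add)
  finally have "1 + exp (- t) \<le> exp e * (1 + exp (- s))" .
  moreover have "1 + exp (- t) > 0" "1 + exp (- s) > 0" by (simp_all add: add_pos_pos)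
  ultimately show ?thesis unfolding logistic_def by (simp add: field_simps)
qed

text \<open>This is the exponential mechanism on two outcomes, with scores plus and minus half of
  the excess of the sum over \<tau>.\<close>

definition logistic_test ::
    "real \<Rightarrow> nat \<Rightarrow> (real \<Rightarrow> real) \<Rightarrow> real \<Rightarrow> real \<Rightarrow> real \<Rightarrow> (nat \<Rightarrow> real) \<Rightarrow> real measure" where
  "logistic_test \<epsilon> n g \<tau> a b d =
     distr (measure_pmf (bernoulli_pmf (logistic (\<epsilon> * ((\<Sum>i<n. g (d i)) - \<tau>))))) borel
       (\<lambda>c. if c then b else a)"

lemma emeasure_logistic_test:
  fixes n :: nat and g :: "real \<Rightarrow> real" and \<epsilon> \<tau> :: real
  assumes E: "E \<in> sets borel"
  defines "q \<equiv> \<lambda>d. logistic (\<epsilon> * ((\<Sum>i<n. g (d i)) - \<tau>))"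
  shows "emeasure (logistic_test \<epsilon> n g \<tau> a b d) E =
           ennreal (q d * indicator E b + (1 - q d) * indicator E a)"
proof -
  have "emeasure (logistic_test \<epsilon> n g \<tau> a b d) E =
      emeasure (measure_pmf (bernoulli_pmf (q d))) {c. (if c then b else a) \<in> E}"
    unfolding logistic_test_def q_def using E by (subst emeasure_distr) (auto simp: vimage_def)
  also have "\<dots> = (\<integral>\<^sup>+c. indicator E (if c then b else a) \<partial>measure_pmf (bernoulli_pmf (q d)))"
    by (subst nn_integral_indicator[symmetric], simp, intro nn_integral_cong) (simp add: indicator_def)
  also have "\<dots> = ennreal (q d) * indicator E b + ennreal (1 - q d) * indicator E a"
    by (subst nn_integral_bernoulli_pmf) (auto simp: q_def logistic_range mult.commute)
  also have "\<dots> = ennreal (q d * indicator E b + (1 - q d) * indicator E a)"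
    by (auto simp: indicator_def q_def logistic_range simp flip: ennreal_plus)
  finally show ?thesis .
qed

lemma measure_logistic_test:
  fixes n :: nat and g :: "real \<Rightarrow> real" and \<epsilon> \<tau> :: real
  assumes E: "E \<in> sets borel"
  defines "q \<equiv> \<lambda>d. logistic (\<epsilon> * ((\<Sum>i<n. g (d i)) - \<tau>))"
  shows "measure (logistic_test \<epsilon> n g \<tau> a b d) E = q d * indicator E b + (1 - q d) * indicator E a"
  unfolding measure_def emeasure_logistic_test[OF E] q_def
  by (subst enn2real_ennreal) (auto simp: logistic_range indicator_def)

text \<open>Replacing one record moves the sum by at most one, hence the logistic argument by at
  most \<epsilon>. Both outcome probabilities change by a factor of at most exp(\<epsilon>), and
  every event combines them with nonnegative weights.\<close>

lemma logistic_test_dp: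
  assumes g[measurable]: "g \<in> borel_measurable borel" and g01: "\<And>x. g x \<in> {0..1}" and \<epsilon>: "\<epsilon> > 0"
  shows "logistic_test \<epsilon> n g \<tau> a b \<in> dp_estimators n \<epsilon>"
proof -
  define q where "q d = logistic (\<epsilon> * ((\<Sum>i<n. g (d i)) - \<tau>))" for d
  have prob: "prob_space (logistic_test \<epsilon> n g \<tau> a b d)" for d
    unfolding logistic_test_def by (intro measure_pmf.prob_space_distr) simp
  have sets_lt: "sets (logistic_test \<epsilon> n g \<tau> a b d) = sets borel" for d
    by (simp add: logistic_test_def)
  have "logistic_test \<epsilon> n g \<tau> a b \<in> estimators n"
    unfolding estimators_def
    by (intro measurable_prob_algebraI measurable_subprob_algebra prob prob_space_imp_subprob_space sets_lt)
       (simp add: emeasure_logistic_test)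
  moreover have "differentially_private n \<epsilon> (logistic_test \<epsilon> n g \<tau> a b)"
    unfolding differentially_private_def
  proof (intro ballI impI)
    fix d d' :: "nat \<Rightarrow> real" and E :: "real set"
    assume "\<exists>!i. i < n \<and> d i \<noteq> d' i" and E: "E \<in> sets borel"
    then obtain j where j: "j < n" "\<And>i. i < n \<Longrightarrow> i \<noteq> j \<Longrightarrow> d i = d' i" by metis
    have "(\<Sum>i<n. g (d i)) - (\<Sum>i<n. g (d' i)) = (\<Sum>i<n. g (d i) - g (d' i))"
      by (simp add: sum_subtractf)
    also have "\<dots> = (\<Sum>i\<in>{j}. g (d i) - g (d' i))"
      using j by (intro sum.mono_neutral_right) auto
    finally have "\<bar>(\<Sum>i<n. g (d i)) - (\<Sum>i<n. g (d' i))\<bar> \<le> 1"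
      using g01[of "d j"] g01[of "d' j"] by auto
    hence "\<epsilon> * \<bar>((\<Sum>i<n. g (d i)) - \<tau>) - ((\<Sum>i<n. g (d' i)) - \<tau>)\<bar> \<le> \<epsilon> * 1"
      using \<epsilon> by (intro mult_left_mono) auto
    hence *: "\<bar>\<epsilon> * ((\<Sum>i<n. g (d i)) - \<tau>) - \<epsilon> * ((\<Sum>i<n. g (d' i)) - \<tau>)\<bar> \<le> \<epsilon>"
      using \<epsilon> by (simp add: abs_mult flip: right_diff_distrib)
    have "q d \<le> exp \<epsilon> * q d'" unfolding q_def by (rule logistic_le_exp_mult[OF *])
    moreover have "1 - q d \<le> exp \<epsilon> * (1 - q d')"
      unfolding q_def logistic_minus[symmetric] using * by (intro logistic_le_exp_mult) auto
    ultimately have "q d * indicator E b + (1 - q d) * indicator E a \<le>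
        exp \<epsilon> * q d' * indicator E b + exp \<epsilon> * (1 - q d') * indicator E a"
      by (intro add_mono mult_right_mono) auto
    thus "measure (logistic_test \<epsilon> n g \<tau> a b d) E \<le> exp \<epsilon> * measure (logistic_test \<epsilon> n g \<tau> a b d') E"
      unfolding measure_logistic_test[OF E] by (simp only: distrib_left mult.assoc flip: q_def)
  qed
  ultimately show ?thesis by (simp add: dp_estimators_def)
qed

section \<open>Error probabilities of the test\<close>

lemma indep_vars_PiM_component:
  assumes P: "prob_space P" "sets P = sets borel" and n: "n > 0"
    and g[measurable]: "g \<in> borel_measurable borel"
  shows "prob_space.indep_vars (\<Pi>\<^sub>M i\<in>{..<n}. P) (\<lambda>_. borel) (\<lambda>i x. g (x i)) {..<n}"
proof -
  let ?P = "\<Pi>\<^sub>M i\<in>{..<n}. P"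
  interpret prob_space ?P by (intro prob_space_PiM P)
  have "indep_vars (\<lambda>_. P) (\<lambda>i x. x i) {..<n}"
  \<comment> \<open>The criterion by joint law asks for a nonempty index set, which is where
    \<open>n > 0\<close> enters.\<close>
  proof (subst indep_vars_iff_distr_eq_PiM')
    have "distr ?P ?P (\<lambda>x. \<lambda>i\<in>{..<n}. x i) = distr ?P ?P (\<lambda>x. x)"
      by (intro distr_cong refl) (auto simp: space_PiM)
    also have "\<dots> = (\<Pi>\<^sub>M i\<in>{..<n}. distr ?P P (\<lambda>x. x i))"
      using distr_PiM_component[of "{..<n}" "\<lambda>_. P"] P by (auto simp: distr_id2 intro!: PiM_cong)
    finally show "distr ?P ?P (\<lambda>x. \<lambda>i\<in>{..<n}. x i) = (\<Pi>\<^sub>M i\<in>{..<n}. distr ?P P (\<lambda>x. x i))" .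
  qed (use n in auto)
  thus ?thesis
    by (rule indep_vars_compose2) (use P in \<open>simp cong: measurable_cong_sets\<close>)
qed

text \<open>The margin 6 sqrt(n) is split in two. Hoeffding keeps the sum within 3 sqrt(n) above its
  mean except with probability exp(-18); the other half and \<epsilon> \<ge> 1 / sqrt(n) push the
  logistic argument below -3. The total is at most 2 exp(-3) \<le> 1/4.\<close>

lemma logistic_error_le:
  fixes n :: nat
  assumes P: "prob_space P" "sets P = sets borel" and n: "n > 0"
    and g[measurable]: "g \<in> borel_measurable borel" and g01: "\<And>x. g x \<in> {0..1}"
    and \<epsilon>: "\<epsilon> \<ge> 1 / sqrt n" and \<tau>: "\<tau> \<ge> n * (LINT x|P. g x) + 6 * sqrt n"
  shows "(LINT d|(\<Pi>\<^sub>M i\<in>{..<n}. P). logistic (\<epsilon> * ((\<Sum>i<n. g (d i)) - \<tau>))) \<le> 1 / 4"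
proof -
  let ?P = "\<Pi>\<^sub>M i\<in>{..<n}. P"
  interpret prob_space ?P by (intro prob_space_PiM P)
  have gP[measurable]: "g \<in> borel_measurable P" using P by (simp cong: measurable_cong_sets)
  define S where "S d = (\<Sum>i<n. g (d i))" for d
  have S[measurable]: "S \<in> borel_measurable ?P" unfolding S_def[abs_def] by measurable
  define \<mu> where "\<mu> = n * (LINT x|P. g x)"
  have mean: "expectation (\<lambda>d. g (d i)) = (LINT x|P. g x)" if "i < n" for i
  proof -
    have "(LINT x|P. g x) = (LINT x|distr ?P P (\<lambda>d. d i). g x)"
      using that by (subst distr_PiM_component) (auto simp: P)
    also have "\<dots> = expectation (\<lambda>d. g (d i))"
      using that by (intro integral_distr) auto
    finally show ?thesis ..
  qed
  interpret H: Hoeffding_ineq ?P "{..<n}" "\<lambda>i d. g (d i)" "\<lambda>_. 0" "\<lambda>_. 1"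
      "\<Sum>i\<in>{..<n}. expectation (\<lambda>d. g (d i))"
  proof unfold_locales
    show "indep_vars (\<lambda>_. borel) (\<lambda>i d. g (d i)) {..<n}"
      by (rule indep_vars_PiM_component[OF P n g])
  qed (use g01 in auto)
  have "prob {d \<in> space ?P. S d \<ge> \<mu> + 3 * sqrt n} \<le> exp (- 2 * (3 * sqrt n)\<^sup>2 / n)"
    using H.Hoeffding_ineq_ge[of "3 * sqrt n"] n by (simp add: mean S_def \<mu>_def)
  also have "\<dots> = exp (- 18)" using n by (simp add: power_mult_distrib)
  finally have tail: "prob {d \<in> space ?P. S d \<ge> \<mu> + 3 * sqrt n} \<le> exp (- 18)" .
  have e3: "exp (- 3 :: real) \<le> 1 / 8"
  proof -
    have "2 ^ 3 \<le> exp (1 :: real) ^ 3" using exp_ge_add_one_self[of 1] by (intro power_mono) auto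
    also have "\<dots> = exp 3" by (simp flip: exp_of_nat_mult)
    finally show ?thesis by (simp add: exp_minus field_simps)
  qed
  have "expectation (\<lambda>d. logistic (\<epsilon> * (S d - \<tau>))) \<le>
      expectation (\<lambda>d. exp (- 3) + indicator {d \<in> space ?P. S d \<ge> \<mu> + 3 * sqrt n} d)"
  proof (rule integral_mono)
    show "integrable ?P (\<lambda>d. logistic (\<epsilon> * (S d - \<tau>)))"
      using logistic_range by (intro integrable_const_bound[where B = 1]) auto
    show "integrable ?P (\<lambda>d. exp (- 3) + indicator {d \<in> space ?P. S d \<ge> \<mu> + 3 * sqrt n} d :: real)"
      by (intro Bochner_Integration.integrable_add integrable_real_indicator)
         (auto simp: emeasure_eq_measure)
    fix d assume d: "d \<in> space ?P"
    show "logistic (\<epsilon> * (S d - \<tau>)) \<le> exp (- 3) + indicator {d \<in> space ?P. S d \<ge> \<mu> + 3 * sqrt n} d"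
    proof (cases "S d \<ge> \<mu> + 3 * sqrt n")
      case True
      thus ?thesis using d logistic_range(2)[of "\<epsilon> * (S d - \<tau>)"] by (auto intro: add_increasing)
    next
      case False
      hence 1: "\<tau> - S d \<ge> 3 * sqrt n" using \<tau> by (simp add: \<mu>_def)
      have "3 = (1 / sqrt n) * (3 * sqrt n)" using n by simp
      also have "\<dots> \<le> \<epsilon> * (\<tau> - S d)" using 1 \<epsilon> by (intro mult_mono) (auto intro: order_trans[OF _ \<epsilon>])
      finally have "\<epsilon> * (S d - \<tau>) \<le> - 3" by (simp add: algebra_simps)
      hence "logistic (\<epsilon> * (S d - \<tau>)) \<le> exp (- 3)" by (intro order_trans[OF logistic_le_exp]) simp
      thus ?thesis using False by simp
    qed
  qed
  also have "\<dots> = exp (- 3) + prob {d \<in> space ?P. S d \<ge> \<mu> + 3 * sqrt n}"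
    by (subst Bochner_Integration.integral_add) (auto simp: emeasure_eq_measure prob_space)
  also have "\<dots> \<le> exp (- 3) + exp (- 3)" using tail by (intro add_mono order_trans[OF tail]) auto
  also have "\<dots> \<le> 1 / 4" using e3 by simp
  finally show ?thesis by (simp add: S_def)
qed

lemma private_test:
  assumes P: "prob_space P" "sets P = sets borel" and Q: "prob_space Q" "sets Q = sets borel"
    and n: "n > 0" and g[measurable]: "g \<in> borel_measurable borel" and g01: "\<And>x. g x \<in> {0..1}"
    and \<epsilon>: "\<epsilon> \<ge> 1 / sqrt n" and gap: "(LINT x|Q. g x) - (LINT x|P. g x) \<ge> 12 / sqrt n"
  shows "\<exists>M \<in> dp_estimators n \<epsilon>. risk n stat P M \<le> 0 \<and> risk n stat Q M \<le> 0"
proof -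
  define p where "p = (LINT x|P. g x)"
  define q where "q = (LINT x|Q. g x)"
  \<comment> \<open>The midpoint of the two expected sums: a gap of 12 sqrt(n) leaves the margin 6
    sqrt(n) on either side.\<close>
  define \<tau> where "\<tau> = (n * p + n * q) / 2"
  define M where "M = logistic_test \<epsilon> n g \<tau> (stat P) (stat Q)"
  have \<epsilon>0: "\<epsilon> > 0" using \<epsilon> n by (auto intro: less_le_trans[OF _ \<epsilon>])
  have dp: "M \<in> dp_estimators n \<epsilon>" unfolding M_def by (rule logistic_test_dp[OF g g01 \<epsilon>0])
  hence M: "M \<in> estimators n" by (simp add: dp_estimators_def)
  have "n * (q - p) \<ge> n * (12 / sqrt n)"
    using gap unfolding p_def q_def by (intro mult_left_mono) auto
  also have "n * (12 / sqrt n) = 12 * sqrt n" using n by (simp add: field_simps flip: power2_eq_square)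
  finally have gap': "n * q - n * p \<ge> 12 * sqrt n" by (simp add: algebra_simps)
  define e where "e d = logistic (\<epsilon> * ((\<Sum>i<n. g (d i)) - \<tau>))" for d
  have M_eq: "measure (M d) E = e d * indicator E (stat Q) + (1 - e d) * indicator E (stat P)"
    if "E \<in> sets borel" for d E
    unfolding M_def e_def by (rule measure_logistic_test[OF that])
  have e01: "0 \<le> e d" "e d \<le> 1" for d
    unfolding e_def by (rule logistic_range)+
  have int_e: "integrable (\<Pi>\<^sub>M i\<in>{..<n}. R) e" if R: "prob_space R" "sets R = sets borel" for R
  proof -
    interpret prob_space "\<Pi>\<^sub>M i\<in>{..<n}. R" by (intro prob_space_PiM R)
    have [measurable]: "g \<in> borel_measurable R" using R by (simp cong: measurable_cong_sets)
    show ?thesis using e01 by (intro integrable_const_bound[where B = 1]) (auto simp: e_def[abs_def])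
  qed
  \<comment> \<open>Here \<open>w\<close> is the probability of the wrong choice given the data. The
    success probability is only bounded below by 1 - w, since the two candidate values may
    coincide.\<close>
  have risk0: "risk n stat R M \<le> 0"
    if R: "prob_space R" "sets R = sets borel"
      and w: "integrable (\<Pi>\<^sub>M i\<in>{..<n}. R) w" "(LINT d|(\<Pi>\<^sub>M i\<in>{..<n}. R). w d) \<le> 1 / 4"
        "\<And>d. 1 - w d \<le> measure (M d) {y. \<bar>y - stat R\<bar> \<le> 0}" for R w
  proof (rule risk_le)
    interpret prob_space "\<Pi>\<^sub>M i\<in>{..<n}. R" by (intro prob_space_PiM R)
    have "3 / 4 \<le> expectation (\<lambda>d. 1 - w d)"
      using w by (simp add: prob_space)
    also have "\<dots> \<le> expectation (\<lambda>d. measure (M d) {y. \<bar>y - stat R\<bar> \<le> 0})"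
      using w by (intro integral_mono prob_space_sample_bind(4)[OF R M]) simp_all
    finally show "3 / 4 \<le> measure ((\<Pi>\<^sub>M i\<in>{..<n}. R) \<bind> M) {y. \<bar>y - stat R\<bar> \<le> 0}"
      unfolding prob_space_sample_bind(3)[OF R M interval_borel] .
  qed simp
  have "risk n stat P M \<le> 0"
  proof (rule risk0[OF P int_e[OF P]])
    show "(LINT d|(\<Pi>\<^sub>M i\<in>{..<n}. P). e d) \<le> 1 / 4"
      unfolding e_def using gap'
      by (intro logistic_error_le P n g g01 \<epsilon>) (simp add: \<tau>_def mult.commute flip: p_def)
  qed (use e01 in \<open>simp add: M_eq\<close>)
  moreover have "risk n stat Q M \<le> 0"
  proof (rule risk0[OF Q])
    interpret Q: prob_space Q by fact
    have [measurable]: "g \<in> borel_measurable Q" using Q by (simp cong: measurable_cong_sets)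
    have "integrable Q g" using g01 by (intro Q.integrable_const_bound[where B = 1]) auto
    hence q': "(LINT x|Q. 1 - g x) = 1 - q" by (simp add: q_def Q.prob_space)
    \<comment> \<open>The error under \<open>Q\<close> is that of the test with statistic 1 - g and
      threshold n - \<tau>, so the same one-sided bound applies.\<close>
    have eq: "1 - e d = logistic (\<epsilon> * ((\<Sum>i<n. 1 - g (d i)) - (n - \<tau>)))" for d
      unfolding e_def logistic_minus[symmetric] by (simp add: sum_subtractf algebra_simps)
    interpret prob_space "\<Pi>\<^sub>M i\<in>{..<n}. Q" by (intro prob_space_PiM Q)
    show "integrable (\<Pi>\<^sub>M i\<in>{..<n}. Q) (\<lambda>d. 1 - e d)" using int_e[OF Q] by simp
    show "(LINT d|(\<Pi>\<^sub>M i\<in>{..<n}. Q). 1 - e d) \<le> 1 / 4"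
      unfolding eq
    proof (rule logistic_error_le[OF Q n _ _ \<epsilon>])
      show "n * (LINT x|Q. 1 - g x) + 6 * sqrt n \<le> n - \<tau>"
        unfolding q' \<tau>_def right_diff_distrib mult_1_right using gap' by argo
    qed (use g01 in auto)
  qed (use e01 in \<open>simp add: M_eq\<close>)
  ultimately show ?thesis using dp by blast
qed

lemma constant_estimator:
  assumes \<epsilon>: "\<epsilon> > 0"
  shows "(\<lambda>_. return borel c) \<in> dp_estimators n \<epsilon>"
    and "prob_space P \<Longrightarrow> sets P = sets borel \<Longrightarrow> risk n stat P (\<lambda>_. return borel c) \<le> \<bar>c - stat P\<bar>"
proof -
  show dp: "(\<lambda>_. return borel c) \<in> dp_estimators n \<epsilon>"
    using \<epsilon> by (auto simp: dp_estimators_def estimators_def differentially_private_def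
        space_prob_algebra prob_space_return mult_right_le_one_le intro!: measurable_const mult_le_cancel_right1[THEN iffD2])
  assume P: "prob_space P" "sets P = sets borel"
  have M: "(\<lambda>_. return borel c) \<in> estimators n" using dp by (simp add: dp_estimators_def)
  show "risk n stat P (\<lambda>_. return borel c) \<le> \<bar>c - stat P\<bar>"
  proof (rule risk_le)
    interpret prob_space "\<Pi>\<^sub>M i\<in>{..<n}. P" by (intro prob_space_PiM P)
    show "3 / 4 \<le> measure ((\<Pi>\<^sub>M i\<in>{..<n}. P) \<bind> (\<lambda>_. return borel c)) {y. \<bar>y - stat P\<bar> \<le> \<bar>c - stat P\<bar>}"
      using prob_space_sample_bind(3)[OF P M interval_borel] by (simp add: measure_return prob_space)
  qed simp
qed

section \<open>The local minimax error\<close>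

context exponential_family
begin

text \<open>The competitor is the member at \<theta> + h. Control is assumed up to \<theta> + 2h
  because the second moment of the likelihood ratio involves A there;
  \<open>n * (h\<^sup>2 * K) \<le> 1 / 8\<close> bounds that moment for the whole sample by exp(1/8)
  < 5/4.\<close>

lemma local_minimax_lower:
  assumes h: "h > 0" and sub: "{\<theta>..\<theta> + 2 * h} \<subseteq> interior \<Theta>"
    and K: "\<And>t. t \<in> {\<theta>..\<theta> + 2 * h} \<Longrightarrow> deriv (deriv A) t \<le> K"
    and n: "n * (h\<^sup>2 * K) \<le> 1 / 8" and F: "F \<subseteq> estimators n"
  shows "ereal (h / 2) \<le> local_minimax n (P \<theta>) (P ` \<Theta>) F (exp_fam_param \<mu>)"
proof -
  have in_\<Theta>: "\<theta> \<in> \<Theta>" "\<theta> + h \<in> \<Theta>" "\<theta> + 2 * h \<in> \<Theta>"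
    using h by (auto intro!: interior_nat_paramsD subsetD[OF sub])
  define l where "l x = exp (h * x - (A (\<theta> + h) - A \<theta>))" for x
  have "(LINT x|P \<theta>. (l x)\<^sup>2) ^ n = exp (n * (A (\<theta> + 2 * h) - 2 * A (\<theta> + h) + A \<theta>))"
    unfolding l_def integral_square_likelihood_ratio[OF in_\<Theta>(1,3)] by (simp add: exp_of_nat_mult)
  also have "\<dots> \<le> exp (1 / 8)"
    using mult_left_mono[OF second_difference_A_le[OF h sub K], of "real n"] n by simp
  also have "exp (1 / 8 :: real) < 5 / 4"
  proof -
    have "7 / 8 \<le> exp (- (1 / 8) :: real)" using exp_ge_add_one_self[of "- (1 / 8)"] by simp
    thus ?thesis by (simp add: exp_minus field_simps)
  qed
  finally have l2: "(LINT x|P \<theta>. (l x)\<^sup>2) ^ n < 5 / 4" .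
  have "h / 2 \<le> max (risk n (exp_fam_param \<mu>) (P \<theta>) M) (risk n (exp_fam_param \<mu>) (P (\<theta> + h)) M)"
    if "M \<in> F" for M
  proof -
    have "\<bar>exp_fam_param \<mu> (P \<theta>) - exp_fam_param \<mu> (P (\<theta> + h))\<bar> / 2 \<le>
        max (risk n (exp_fam_param \<mu>) (P \<theta>) M) (risk n (exp_fam_param \<mu>) (P (\<theta> + h)) M)"
    proof (rule two_point_lower_bound[where l = l])
      show "P (\<theta> + h) = density (P \<theta>) (\<lambda>x. ennreal (l x))"
        using P_eq_density[of "\<theta> + h" \<theta>] by (simp add: l_def)
      show "integrable (P \<theta>) (\<lambda>x. (l x)\<^sup>2)"
        unfolding l_def by (rule integrable_square_likelihood_ratio[OF in_\<Theta>(1,3)])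
    qed (use that F in_\<Theta> l2 in \<open>auto simp: prob_space_P l_def[abs_def]\<close>)
    thus ?thesis using h in_\<Theta> by (simp add: exp_fam_param_P)
  qed
  thus ?thesis
    unfolding local_minimax_def using in_\<Theta>
    by (intro SUP_upper2[of "P (\<theta> + h)"] INF_greatest) (auto simp only: ereal_less_eq)
qed

lemma local_minimax_upper:
  fixes m s R D \<zeta> :: real
  assumes D: "D > 0" and sub: "{\<theta> - D / 2..\<theta> + D / 2} \<subseteq> interior \<Theta>"
    and s: "s > 0" and R: "R > 1" "4 * \<zeta> \<le> (R - 1)\<^sup>2"
    and mean: "\<And>t. t \<in> {\<theta> - D / 2..\<theta> + D / 2} \<Longrightarrow> \<bar>deriv A t - m\<bar> \<le> s"
    and var: "\<And>t. t \<in> {\<theta> - D / 2..\<theta> + D / 2} \<Longrightarrow> deriv (deriv A) t \<in> {s\<^sup>2 / 2..2 * s\<^sup>2}"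
    and mom4: "\<And>t. t \<in> {\<theta> - D / 2..\<theta> + D / 2} \<Longrightarrow>
        (LINT x|P t. (x - deriv A t) ^ 4) / (deriv (deriv A) t)\<^sup>2 \<le> \<zeta>"
    and n: "n > 0" and gap: "12 / sqrt n \<le> D / 2 * s / (8 * R)" and \<epsilon>: "\<epsilon> \<ge> 1 / sqrt n"
  shows "local_minimax n (P \<theta>) (P ` \<Theta>) (dp_estimators n \<epsilon>) (exp_fam_param \<mu>) \<le> ereal (D / 2)"
  unfolding local_minimax_def
proof (intro SUP_least)
  fix Q assume "Q \<in> P ` \<Theta>"
  then obtain t where t: "t \<in> \<Theta>" "Q = P t" by auto
  have \<theta>: "\<theta> \<in> \<Theta>" "\<theta> - D / 2 \<in> \<Theta>" "\<theta> + D / 2 \<in> \<Theta>"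
    using D by (auto intro!: interior_nat_paramsD subsetD[OF sub])
  have \<epsilon>0: "\<epsilon> > 0" using \<epsilon> n by (auto intro: less_le_trans[OF _ \<epsilon>])
  define g where "g x = clamp01 R ((x - m) / s)" for x
  have g: "g \<in> borel_measurable borel" by (simp add: g_def[abs_def])
  have g01: "g x \<in> {0..1}" for x using clamp01_range R by (simp add: g_def)
  have mono_g: "mono g"
    unfolding g_def using R s by (intro monoI monoD[OF mono_clamp01]) (auto intro!: divide_right_mono)
  have g_mono: "(LINT x|P a. g x) \<le> (LINT x|P b. g x)" if "a \<le> b" "a \<in> \<Theta>" "b \<in> \<Theta>" for a b
    using that g01 by (intro integral_P_mono_param[OF _ _ _ g mono_g, of _ _ 1]) (auto simp: abs_le_iff)
  \<comment> \<open>Used for the half of the controlled interval on either side of \<theta>;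
    monotonicity of the mean then extends the gap to all parameters further away.\<close>
  have g_gap: "12 / sqrt n \<le> (LINT x|P b. g x) - (LINT x|P a. g x)"
    if "b - a = D / 2" "{a..b} \<subseteq> {\<theta> - D / 2..\<theta> + D / 2}" for a b
  proof -
    have "(b - a) * s / (8 * R) \<le> (LINT x|P b. g x) - (LINT x|P a. g x)"
      unfolding g_def
      by (rule mean_clamp_gap[OF _ _ s R]) (use that sub D mean var mom4 in auto)
    thus ?thesis using gap that by simp
  qed
  \<comment> \<open>The infimum stands inside the supremum, so the estimator may be chosen knowing
    \<open>t\<close>.\<close>
  have "\<exists>M\<in>dp_estimators n \<epsilon>. risk n (exp_fam_param \<mu>) (P \<theta>) M \<le> D / 2 \<and> risk n (exp_fam_param \<mu>) (P t) M \<le> D / 2"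
  proof (cases "\<bar>t - \<theta>\<bar> \<le> D")
    case True
    have "risk n (exp_fam_param \<mu>) (P u) (\<lambda>_. return borel ((t + \<theta>) / 2)) \<le> D / 2" if "u \<in> {t, \<theta>}" for u
      using constant_estimator(2)[OF \<epsilon>0 prob_space_P sets_P, of u n "exp_fam_param \<mu>" "(t + \<theta>) / 2"]
        that True t \<theta> by (auto simp: exp_fam_param_P field_simps abs_if split: if_splits)
    thus ?thesis using constant_estimator(1)[OF \<epsilon>0] by blast
  next
    case False
    have test: "\<exists>M\<in>dp_estimators n \<epsilon>. risk n (exp_fam_param \<mu>) (P a) M \<le> 0 \<and> risk n (exp_fam_param \<mu>) (P b) M \<le> 0"
      if "a \<in> \<Theta>" "b \<in> \<Theta>" "12 / sqrt n \<le> (LINT x|P b. g x) - (LINT x|P a. g x)" for a b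
      by (rule private_test[OF _ _ _ _ n g g01 \<epsilon>]) (use that prob_space_P in auto)
    show ?thesis
    proof (cases "t > \<theta>")
      case True
      have "12 / sqrt n \<le> (LINT x|P t. g x) - (LINT x|P \<theta>. g x)"
        using g_gap[of "\<theta> + D / 2" \<theta>] g_mono[of "\<theta> + D / 2" t] True False \<theta> t D by auto
      from test[OF \<theta>(1) t(1) this] show ?thesis using D by force
    next
      \<comment> \<open>Below \<theta> the two hypotheses swap places, as the test expects the
        larger mean at its second law.\<close>
      case t_less: False
      have "12 / sqrt n \<le> (LINT x|P \<theta>. g x) - (LINT x|P t. g x)"
        using g_gap[of \<theta> "\<theta> - D / 2"] g_mono[of t "\<theta> - D / 2"] t_less False \<theta> t D by auto
      from test[OF t(1) \<theta>(1) this] show ?thesis using D by force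
    qed
  qed
  thus "(INF M\<in>dp_estimators n \<epsilon>. ereal (max (risk n (exp_fam_param \<mu>) (P \<theta>) M)
      (risk n (exp_fam_param \<mu>) Q M))) \<le> ereal (D / 2)"
    by (auto simp: t intro: INF_lower2)
qed

text \<open>Strict inequality provides an admissible radius above \<open>r\<close>, whether or not
  the supremum is attained.\<close>

lemma kappa_greaterD:
  assumes \<theta>: "\<theta> \<in> interior \<Theta>" and r: "ereal r < kappa \<mu> \<theta>" and t: "t \<in> {\<theta> - r..\<theta> + r}"
  shows "t \<in> interior \<Theta>" and "t \<in> kappa_interval \<mu> \<theta>"
    and "deriv (deriv A) t \<in> {deriv (deriv A) \<theta> / 2..2 * deriv (deriv A) \<theta>}"
proof -
  from r obtain r' where r': "r < r'" "{\<theta> - r'..\<theta> + r'} \<subseteq> interior \<Theta>"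
      "\<forall>t\<in>{\<theta> - r'..\<theta> + r'}. deriv (deriv A) \<theta> / deriv (deriv A) t \<in> {1/2..2}"
    unfolding kappa_def less_Sup_iff by auto
  have t': "t \<in> {\<theta> - r'..\<theta> + r'}" using t r' by auto
  with r' show int: "t \<in> interior \<Theta>" by blast
  have "deriv (deriv A) \<theta> / deriv (deriv A) t \<in> {1/2..2}" using r' t' by blast
  thus "deriv (deriv A) t \<in> {deriv (deriv A) \<theta> / 2..2 * deriv (deriv A) \<theta>}"
    using deriv2_A_pos[OF int] by (simp add: field_simps)
  show "t \<in> kappa_interval \<mu> \<theta>"
    \<comment> \<open>The case split covers an infinite \<open>kappa\<close>.\<close>
    using r t unfolding kappa_interval_def by (cases "kappa \<mu> \<theta>") auto
qed

end

section \<open>Choice of constants and conclusion\<close>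

theorem corollary4p14:
  fixes \<zeta> :: real
  assumes "\<zeta> > 0"
  shows "\<exists>(k::real) (C1::real) (C2::real) (N::nat). k > 0 \<and> C1 > 0 \<and> C2 > 0 \<and> N > 0 \<and>
    (\<forall>(\<mu>::real measure) (\<theta>\<^sub>0::real) (n::nat) (\<epsilon>::nat \<Rightarrow> real).
       sets \<mu> = sets borel \<longrightarrow>
       \<not> concentrated_at_point \<mu> \<longrightarrow>
       \<theta>\<^sub>0 \<in> interior (nat_params \<mu>) \<longrightarrow>
       n \<ge> N \<longrightarrow>
       (\<forall>m. \<epsilon> m > 0) \<longrightarrow>
       \<epsilon> n \<ge> k / sqrt (real n) \<longrightarrow>
       (\<forall>\<theta>' \<in> kappa_interval \<mu> \<theta>\<^sub>0 \<inter> interior (nat_params \<mu>).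
          (LINT x|exp_fam \<mu> \<theta>'. (x - deriv (log_partition \<mu>) \<theta>') ^ 4)
            / (deriv (deriv (log_partition \<mu>)) \<theta>')\<^sup>2 \<le> \<zeta>) \<longrightarrow>
       kappa \<mu> \<theta>\<^sub>0 \<ge> ereal (C2 / sqrt (real n * deriv (deriv (log_partition \<mu>)) \<theta>\<^sub>0)) \<longrightarrow>
       local_minimax n (exp_fam \<mu> \<theta>\<^sub>0) (exp_fam \<mu> ` nat_params \<mu>) (dp_estimators n (\<epsilon> n))
           (exp_fam_param \<mu>)
         \<in> {ereal (C1 / (2 * sqrt (real n * deriv (deriv (log_partition \<mu>)) \<theta>\<^sub>0)))
            .. ereal (C2 / (2 * sqrt (real n * deriv (deriv (log_partition \<mu>)) \<theta>\<^sub>0)))})"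
proof -
  \<comment> \<open>Then (R - 1)^2 = (1 + 4\<zeta>)^2, which exceeds 4\<zeta>.\<close>
  define R where "R = 2 + 4 * \<zeta>"
  \<comment> \<open>At D = C2 / (s sqrt(n)) the gap D/2 * s / (8 R) equals C2 / (16 R sqrt(n)), that
    is 12 / sqrt(n).\<close>
  define C2 where "C2 = 192 * R"
  \<comment> \<open>Ensures C2 \<le> sqrt(n), so that A' varies by at most \<open>s\<close> over the
    interval of radius D/2.\<close>
  define N where "N = nat \<lceil>C2\<^sup>2\<rceil>"
  have R: "R > 1" "4 * \<zeta> \<le> (R - 1)\<^sup>2"
    using assms by (simp_all add: R_def power2_eq_square algebra_simps)
  have C2: "C2 > 0" using R by (simp add: C2_def)
  hence "N > 0" by (simp add: N_def)
  show ?thesis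
  proof (rule exI[of _ 1], rule exI[of _ "1 / 4"], rule exI[of _ C2], rule exI[of _ N],
      intro conjI allI impI)
    fix \<mu> :: "real measure" and \<theta> :: real and n :: nat and \<epsilon> :: "nat \<Rightarrow> real"
    assume mu: "sets \<mu> = sets borel" "\<not> concentrated_at_point \<mu>"
      and \<theta>: "\<theta> \<in> interior (nat_params \<mu>)" and n: "n \<ge> N" and \<epsilon>: "1 / sqrt n \<le> \<epsilon> n"
      and mom4: "\<forall>\<theta>'\<in>kappa_interval \<mu> \<theta> \<inter> interior (nat_params \<mu>).
          (LINT x|exp_fam \<mu> \<theta>'. (x - deriv (log_partition \<mu>) \<theta>') ^ 4)
            / (deriv (deriv (log_partition \<mu>)) \<theta>')\<^sup>2 \<le> \<zeta>"
      and kappa: "ereal (C2 / sqrt (n * deriv (deriv (log_partition \<mu>)) \<theta>)) \<le> kappa \<mu> \<theta>"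
    interpret exponential_family \<mu> by unfold_locales (use mu in auto)
    define s where "s = sqrt (deriv (deriv A) \<theta>)"
    have s: "s > 0" "s\<^sup>2 = deriv (deriv A) \<theta>" using deriv2_A_pos[OF \<theta>] by (simp_all add: s_def)
    have n0: "n > 0" using n \<open>N > 0\<close> by simp
    define w where "w = sqrt n * s"
    have w: "w > 0" "sqrt (n * deriv (deriv A) \<theta>) = w" "w\<^sup>2 = n * s\<^sup>2"
      using n0 s by (simp_all add: w_def s_def real_sqrt_mult power_mult_distrib)
    have "C2\<^sup>2 \<le> n" using n by (simp add: N_def nat_le_iff ceiling_le_iff)
    hence sqrt_n: "C2 \<le> sqrt n" by (simp add: real_le_rsqrt)
    define D where "D = C2 / w"
    have D: "D > 0" using C2 w by (simp add: D_def)
    \<comment> \<open>The hypothesis gives \<open>kappa\<close> at least \<open>D\<close>; passing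
      to D/2 makes the inequality strict.\<close>
    have "ereal (D / 2) < kappa \<mu> \<theta>"
      using D kappa by (intro less_le_trans[OF _ kappa]) (simp add: w D_def)
    note near = kappa_greaterD[OF \<theta> this, folded s(2)]
    \<comment> \<open>With C1 = 1/4 this is C1 / w, and n h^2 * 2 s^2 = 2/16 meets the budget 1/8 of
      the lower bound exactly.\<close>
    define h where "h = 1 / 4 / w"
    have h: "h > 0" "2 * h \<le> D / 2" using w R by (simp_all add: h_def D_def C2_def field_simps)

    have "ereal (h / 2) \<le> local_minimax n (P \<theta>) (P ` \<Theta>) (dp_estimators n (\<epsilon> n)) (exp_fam_param \<mu>)"
    proof (rule local_minimax_lower[OF h(1), of _ "2 * s\<^sup>2"])
      show "n * (h\<^sup>2 * (2 * s\<^sup>2)) \<le> 1 / 8"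
        using w(1,3) s n0 by (simp add: h_def power_divide field_simps)
      show "deriv (deriv A) t \<le> 2 * s\<^sup>2" if "t \<in> {\<theta>..\<theta> + 2 * h}" for t
        using near(3)[of t] that h D by auto
    qed (use near(1) h D in \<open>auto simp: dp_estimators_def\<close>)
    moreover have "local_minimax n (P \<theta>) (P ` \<Theta>) (dp_estimators n (\<epsilon> n)) (exp_fam_param \<mu>) \<le> ereal (D / 2)"
    proof (rule local_minimax_upper[OF D _ s(1) R, where m = "deriv A \<theta>"])
      fix t assume t: "t \<in> {\<theta> - D / 2..\<theta> + D / 2}"
      have "\<bar>deriv A t - deriv A \<theta>\<bar> \<le> 2 * s\<^sup>2 * \<bar>t - \<theta>\<bar>"
      proof -
        have "norm (deriv A t - deriv A \<theta>) \<le> 2 * s\<^sup>2 * norm (t - \<theta>)"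
        proof (rule field_differentiable_bound[where S = "{\<theta> - D / 2..\<theta> + D / 2}" and f' = "deriv (deriv A)"])
          fix z assume z: "z \<in> {\<theta> - D / 2..\<theta> + D / 2}"
          show "(deriv A has_field_derivative deriv (deriv A) z) (at z within {\<theta> - D / 2..\<theta> + D / 2})"
            using deriv_A_has_derivative[OF near(1)[OF z]]
            by (simp add: deriv2_A[OF near(1)[OF z]] has_field_derivative_at_within)
          show "norm (deriv (deriv A) z) \<le> 2 * s\<^sup>2"
            using near(3)[OF z] deriv2_A_pos[OF near(1)[OF z]] by simp
        qed (use t D in auto)
        thus ?thesis by simp
      qed
      also have "\<dots> \<le> 2 * s\<^sup>2 * (D / 2)"
        by (intro mult_left_mono abs_leI) (use t in auto)
      also have "\<dots> = s * (C2 / sqrt n)"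
        using s n0 by (simp add: D_def w_def power2_eq_square field_simps)
      also have "\<dots> \<le> s * 1"
        using s sqrt_n n0 by (intro mult_left_mono) auto
      finally show "\<bar>deriv A t - deriv A \<theta>\<bar> \<le> s" by simp
      show "deriv (deriv A) t \<in> {s\<^sup>2 / 2..2 * s\<^sup>2}" by (rule near(3)[OF t])
      show "(LINT x|P t. (x - deriv A t) ^ 4) / (deriv (deriv A) t)\<^sup>2 \<le> \<zeta>"
        using mom4 near(1,2)[OF t] by blast
    next
      show "12 / sqrt n \<le> D / 2 * s / (8 * R)"
        using s R n0 by (simp add: D_def w_def C2_def)
    qed (use near(1) n0 \<epsilon> in auto)
    ultimately show "local_minimax n (P \<theta>) (P ` \<Theta>) (dp_estimators n (\<epsilon> n)) (exp_fam_param \<mu>)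
        \<in> {ereal (1 / 4 / (2 * sqrt (n * deriv (deriv A) \<theta>)))..ereal (C2 / (2 * sqrt (n * deriv (deriv A) \<theta>)))}"
      by (simp add: w h_def D_def mult.commute)
  qed (use C2 \<open>N > 0\<close> in auto)
qed

end
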